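(* Let $\Bbbk$ be an algebraically closed field of characteristic $p>0$, let $G$ be a closed subgroup of $\operatorname{GL}_2(\Bbbk)$ containing an infinite unipotent subgroup, and let $V$ denote the restriction to $G$ of the natural $2$-dimensional $\operatorname{GL}_2(\Bbbk)$-module. For any integer $n\ge 0$ set $V_n:=\operatorname{Hom}_{\Bbbk}(S^{p^n-1}(V),S^{p^n-1}(V))$. Then $\delta(G,V_n)\ge p^n$.
   Context: $\operatorname{Hom}_\Bbbk(W,W)$ carries the usual conjugation action of $G$ for a $G$-module $W$. For a $G$-module (finite-dimensional rational representation) $W$, $\Bbbk[W]\cong S(W^* )$ is the ring of polynomial functions on $W$, with $G$-action $(g\cdot f)(w)=f(g^{-1}w)$ and invariant ring $\Bbbk[W]^G$, graded by degree. $\Bbbk[W]^G_{\le d}$ is the set of invariants of degree at most $d$. For $S\subseteq \Bbbk[W]$, $S_+$ is the set of elements of $S$ with constant term zero. The nullcone $\mathcal{N}_{G,W}\subseteq W$ is the common zero set of $\Bbbk[W]^G_+$. A subset $S\subseteq\Bbbk[W]^G$ is a $\delta$-set if for every $w\in W^G\setminus\mathcal{N}_{G,W}$ there is $f\in S_+$ with $f(w)\neq 0$. Define $\delta(G,W)=\min\{d\ge 0 : \Bbbk[W]^G_{\le d}\text{ is a }\delta\text{-set}\}$. *)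

theory Defs
  imports
    "HOL-Analysis.Analysis"
    "HOL-Algebra.Group"
    "HOL-Computational_Algebra.Polynomial"
    "HOL-Library.Poly_Mapping"
    "HOL-Library.Function_Algebras"
begin

(* Addition and zero come from the type classes of 'w; only the carrier, the scalar
   multiplication and the group action are explicit. *)
record ('k, 'g, 'w) gmodule =
  rep_space :: "'w set"
  rep_scale :: "'k \<Rightarrow> 'w \<Rightarrow> 'w"
  rep_act :: "'g \<Rightarrow> 'w \<Rightarrow> 'w"

definition linear_map_on ::
    "('k \<Rightarrow> 'v \<Rightarrow> 'v) \<Rightarrow> ('k \<Rightarrow> 'u \<Rightarrow> 'u) \<Rightarrow> 'v set \<Rightarrow> ('v::plus \<Rightarrow> 'u::plus) \<Rightarrow> bool" where
  "linear_map_on s t W f \<longleftrightarrow>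
     (\<forall>x\<in>W. \<forall>y\<in>W. f (x + y) = f x + f y) \<and> (\<forall>c. \<forall>x\<in>W. f (s c x) = t c (f x))"


(* Polynomial functions are represented by total functions of which only the values on W
   are ever used. polyfun_le s W d f says that, on W, f is a polynomial function of degree at
   most d, i.e. a linear combination of products of at most d linear forms. Over an infinite
   field this is the degree filtration of the symmetric algebra of the dual of W. *)

inductive polyfun_le :: "('k::comm_ring_1 \<Rightarrow> 'w::plus \<Rightarrow> 'w) \<Rightarrow> 'w set \<Rightarrow> nat \<Rightarrow> ('w \<Rightarrow> 'k) \<Rightarrow> bool"
  for s :: "'k \<Rightarrow> 'w \<Rightarrow> 'w" and W :: "'w set" where
  const: "polyfun_le s W d (\<lambda>w. c)"
| linear: "linear_map_on s (*) W f \<Longrightarrow> polyfun_le s W 1 f"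
| add: "polyfun_le s W d f \<Longrightarrow> polyfun_le s W d g \<Longrightarrow> polyfun_le s W d (\<lambda>w. f w + g w)"
| mult: "polyfun_le s W d f \<Longrightarrow> polyfun_le s W e g \<Longrightarrow> polyfun_le s W (d + e) (\<lambda>w. f w * g w)"
| mono: "polyfun_le s W d f \<Longrightarrow> d \<le> e \<Longrightarrow> polyfun_le s W e f"

definition polyfuns :: "('k::comm_ring_1 \<Rightarrow> 'w::plus \<Rightarrow> 'w) \<Rightarrow> 'w set \<Rightarrow> ('w \<Rightarrow> 'k) set" where
  "polyfuns s W = {f. \<exists>d. polyfun_le s W d f}"


definition fun_action :: "('g, 'b) monoid_scheme \<Rightarrow> ('k, 'g, 'w) gmodule \<Rightarrow> 'g \<Rightarrow> ('w \<Rightarrow> 'k) \<Rightarrow> 'w \<Rightarrow> 'k" where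
  "fun_action \<Gamma> M g f = (\<lambda>w. f (rep_act M (inv\<^bsub>\<Gamma>\<^esub> g) w))"

definition invariants ::
    "('g, 'b) monoid_scheme \<Rightarrow> ('k::comm_ring_1, 'g, 'w::plus) gmodule \<Rightarrow> ('w \<Rightarrow> 'k) set" where
  "invariants \<Gamma> M = {f \<in> polyfuns (rep_scale M) (rep_space M).
     \<forall>g\<in>carrier \<Gamma>. \<forall>w\<in>rep_space M. fun_action \<Gamma> M g f w = f w}"

definition invariants_le ::
    "('g, 'b) monoid_scheme \<Rightarrow> ('k::comm_ring_1, 'g, 'w::plus) gmodule \<Rightarrow> nat \<Rightarrow> ('w \<Rightarrow> 'k) set" where
  "invariants_le \<Gamma> M d = {f \<in> invariants \<Gamma> M. polyfun_le (rep_scale M) (rep_space M) d f}"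

(* The constant term of a polynomial function is its value at the origin. *)
definition plus_part :: "('w::zero \<Rightarrow> 'k::zero) set \<Rightarrow> ('w \<Rightarrow> 'k) set" where
  "plus_part S = {f \<in> S. f 0 = 0}"

definition nullcone ::
    "('g, 'b) monoid_scheme \<Rightarrow> ('k::comm_ring_1, 'g, 'w::monoid_add) gmodule \<Rightarrow> 'w set" where
  "nullcone \<Gamma> M = {w \<in> rep_space M. \<forall>f \<in> plus_part (invariants \<Gamma> M). f w = 0}"

definition fixed_points :: "('g, 'b) monoid_scheme \<Rightarrow> ('k, 'g, 'w) gmodule \<Rightarrow> 'w set" where
  "fixed_points \<Gamma> M = {w \<in> rep_space M. \<forall>g\<in>carrier \<Gamma>. rep_act M g w = w}"

definition delta_set ::
    "('g, 'b) monoid_scheme \<Rightarrow> ('k::comm_ring_1, 'g, 'w::monoid_add) gmodule \<Rightarrow> ('w \<Rightarrow> 'k) set \<Rightarrow> bool" where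
  "delta_set \<Gamma> M S \<longleftrightarrow> S \<subseteq> invariants \<Gamma> M \<and>
     (\<forall>w \<in> fixed_points \<Gamma> M - nullcone \<Gamma> M. \<exists>f \<in> plus_part S. f w \<noteq> 0)"

(* For finite-dimensional modules the minimum exists because k[W] is Noetherian. *)
definition delta :: "('g, 'b) monoid_scheme \<Rightarrow> ('k::comm_ring_1, 'g, 'w::monoid_add) gmodule \<Rightarrow> nat" where
  "delta \<Gamma> M = (LEAST d. delta_set \<Gamma> M (invariants_le \<Gamma> M d))"


(* Hom_k(M, M) with the conjugation action. A linear map M --> M is represented by the total
   function that vanishes outside the carrier of M. *)
definition hom_module ::
    "('g, 'b) monoid_scheme \<Rightarrow> ('k, 'g, 'w::monoid_add) gmodule \<Rightarrow> ('k, 'g, 'w \<Rightarrow> 'w) gmodule" where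
  "hom_module \<Gamma> M = \<lparr>
     rep_space = {T. linear_map_on (rep_scale M) (rep_scale M) (rep_space M) T \<and>
                 (\<forall>x\<in>rep_space M. T x \<in> rep_space M) \<and> (\<forall>x. x \<notin> rep_space M \<longrightarrow> T x = 0)},
     rep_scale = (\<lambda>c T x. rep_scale M c (T x)),
     rep_act = (\<lambda>g T x. if x \<in> rep_space M then rep_act M g (T (rep_act M (inv\<^bsub>\<Gamma>\<^esub> g) x)) else 0)\<rparr>"


definition GL2 :: "('k::field ^ 2 ^ 2) monoid" where
  "GL2 = \<lparr>carrier = {A. invertible A}, monoid.mult = (**), one = mat 1\<rparr>"

(* Zariski closedness in GL_2, the principal open subset det \<noteq> 0 of the space of 2x2 matrices:
   as powers of 1/det can be cleared, polynomials in the four matrix entries suffice. *)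
definition closed_in_GL2 :: "('k::field ^ 2 ^ 2) set \<Rightarrow> bool" where
  "closed_in_GL2 G \<longleftrightarrow> (\<exists>I \<subseteq> polyfuns (\<lambda>c A. \<chi> i j. c * A $ i $ j) UNIV.
     G = {A \<in> carrier GL2. \<forall>f\<in>I. f A = 0})"

(* h - 1 is nilpotent; the powers are for matrix multiplication, times on vectors being
   componentwise. *)
definition unipotent :: "'k::field ^ 2 ^ 2 \<Rightarrow> bool" where
  "unipotent h \<longleftrightarrow> (\<exists>m. (((**) (h - mat 1)) ^^ m) (mat 1) = 0)"


(* The symmetric algebra S(V) of V = k^2 is the polynomial ring in the standard basis vectors
   e_1, e_2 of V; g acts by the algebra endomorphism extending e_j |-> g e_j = sum_i g_ij e_i. *)

type_synonym 'k symalg = "(2 \<Rightarrow>\<^sub>0 nat) \<Rightarrow>\<^sub>0 'k"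

definition sym_const :: "'k::field \<Rightarrow> 'k symalg" where
  "sym_const c = Poly_Mapping.single 0 c"

definition sym_gen :: "2 \<Rightarrow> 'k::field symalg" where
  "sym_gen i = Poly_Mapping.single (Poly_Mapping.single i 1) 1"

definition sym_action :: "'k::field ^ 2 ^ 2 \<Rightarrow> 'k symalg \<Rightarrow> 'k symalg" where
  "sym_action g P = (\<Sum>m\<in>Poly_Mapping.keys P. sym_const (Poly_Mapping.lookup P m) *
     (\<Prod>j\<in>UNIV. (\<Sum>i\<in>UNIV. sym_const (g $ i $ j) * sym_gen i) ^ Poly_Mapping.lookup m j))"

definition sym_power :: "nat \<Rightarrow> ('k::field, 'k ^ 2 ^ 2, 'k symalg) gmodule" where
  "sym_power d = \<lparr>
     rep_space = {P. \<forall>m\<in>Poly_Mapping.keys P. (\<Sum>j\<in>UNIV. Poly_Mapping.lookup m j) = d},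
     rep_scale = (\<lambda>c P. sym_const c * P),
     rep_act = sym_action\<rparr>"

end

theory Submission
  imports Defs "Jordan_Normal_Form.Determinant"
begin

text \<open>
  Write \<open>q = p ^ n\<close>, let \<open>St = S\<^sup>q\<^sup>-\<^sup>1(V)\<close> and \<open>W = End(St)\<close>. Up to conjugation, \<open>G\<close> contains the
  group \<open>U\<close> of all upper unitriangular matrices \<open>u\<^sub>t\<close>: an infinite unipotent subgroup lies in \<open>U\<close> after
  conjugation, and it is Zariski dense in \<open>U\<close>. The identity of \<open>St\<close> is a fixed point on which the
  invariant \<open>det\<close> does not vanish.

  \<^emph>\<open>No invariant of degree below \<open>q\<close> detects the identity.\<close> Let \<open>E\<close> be the additive group of the
  subfield with \<open>q\<close> elements. As an \<open>E\<close>-module \<open>St\<close> is free of rank one, so the identity is a trace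
  \<open>\<Sum>a\<in>E. u\<^sub>a Z u\<^sub>-\<^sub>a\<close>. Restricting an invariant to the span of the \<open>u\<^sub>a Z u\<^sub>-\<^sub>a\<close> gives a polynomial in variables
  indexed by \<open>E\<close> and invariant under translations. Its value at \<open>(1, \<dots>, 1)\<close> is a sum over
  \<open>E\<close>-orbits of monomials, and modulo \<open>p\<close> only the powers of the product of all \<open>q\<close> variables survive.

  \<^emph>\<open>The minimum defining \<open>\<delta>\<close> is attained\<close> (over an empty set of degrees it would be an unspecified
  number). A fixed point \<open>w\<close> of \<open>U\<close> is an upper triangular matrix with constant diagonal \<open>c\<close>, and
  every \<open>U\<close>-invariant \<open>f\<close> satisfies \<open>f w = f (c \<cdot> id)\<close>. Hence a fixed point outside the nullcone has
  \<open>c \<noteq> 0\<close>, and \<open>det\<close>, of degree \<open>q\<close>, detects it.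
\<close>

no_notation vec_index (infixl "$" 100)

abbreviation id2 :: "'k::field ^ 2 ^ 2" where
  "id2 \<equiv> Finite_Cartesian_Product.mat 1"

subsection \<open>Polynomial functions in finitely many variables\<close>

text \<open>Requiring zero off \<open>J\<close> keeps the set finite for finite \<open>J\<close> and
  makes distinct exponents distinct monomials in the variables of \<open>J\<close>.\<close>

definition exponents :: "'i set \<Rightarrow> nat \<Rightarrow> ('i \<Rightarrow> nat) set" where
  "exponents J d = {k. (\<forall>j. j \<notin> J \<longrightarrow> k j = 0) \<and> sum k J \<le> d}"

definition monomial_val :: "'i set \<Rightarrow> ('i \<Rightarrow> nat) \<Rightarrow> ('i \<Rightarrow> 'k::comm_ring_1) \<Rightarrow> 'k" where
  "monomial_val J k x = (\<Prod>j\<in>J. x j ^ k j)"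

text \<open>Polynomials appear as functions whose coefficients are only asserted to exist; over an
  infinite integral domain \<open>mpoly_coeffs_unique\<close> makes them unique.\<close>

definition mpoly_fun :: "'i set \<Rightarrow> nat \<Rightarrow> (('i \<Rightarrow> 'k::comm_ring_1) \<Rightarrow> 'k) \<Rightarrow> bool" where
  "mpoly_fun J d \<phi> \<longleftrightarrow> (\<exists>c. \<forall>x. \<phi> x = (\<Sum>k\<in>exponents J d. c k * monomial_val J k x))"

lemma finite_exponents:
  assumes "finite J"
  shows "finite (exponents J d)"
proof (rule finite_subset)
  show "exponents J d \<subseteq> {k. \<forall>j. (j \<in> J \<longrightarrow> k j \<in> {..d}) \<and> (j \<notin> J \<longrightarrow> k j = 0)}"
    using assms by (auto simp: exponents_def intro: order_trans[OF member_le_sum])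
  show "finite {k. \<forall>j. (j \<in> J \<longrightarrow> k j \<in> {..d}) \<and> (j \<notin> J \<longrightarrow> k j = (0::nat))}"
    using assms by (intro finite_set_of_finite_funs) auto
qed

lemma exponents_mono: "d \<le> e \<Longrightarrow> exponents J d \<subseteq> exponents J e"
  by (auto simp: exponents_def)

lemma mpoly_fun_cmonomial:
  assumes "finite J" "k \<in> exponents J d"
  shows "mpoly_fun J d (\<lambda>x. c * monomial_val J k x)"
  unfolding mpoly_fun_def
proof (intro exI allI)
  fix x
  show "c * monomial_val J k x =
      (\<Sum>l\<in>exponents J d. (if l = k then c else 0) * monomial_val J l x)"
    using assms by (simp add: finite_exponents if_distrib[of "\<lambda>a. a * _"] sum.delta cong: if_cong)
qed

lemma mpoly_fun_add:
  assumes "mpoly_fun J d \<phi>" "mpoly_fun J d \<psi>"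
  shows "mpoly_fun J d (\<lambda>x. \<phi> x + \<psi> x)"
proof -
  obtain a b where "\<And>x. \<phi> x = (\<Sum>k\<in>exponents J d. a k * monomial_val J k x)"
    "\<And>x. \<psi> x = (\<Sum>k\<in>exponents J d. b k * monomial_val J k x)"
    using assms by (auto simp: mpoly_fun_def)
  then show ?thesis
    unfolding mpoly_fun_def
    by (intro exI[of _ "\<lambda>k. a k + b k"]) (auto simp: algebra_simps sum.distrib)
qed

lemma mpoly_fun_sum:
  assumes "finite S" "\<And>s. s \<in> S \<Longrightarrow> mpoly_fun J d (\<phi> s)"
  shows "mpoly_fun J d (\<lambda>x. \<Sum>s\<in>S. \<phi> s x)"
  using assms
proof (induction S rule: finite_induct)
  case empty
  show ?case unfolding mpoly_fun_def by (intro exI[of _ "\<lambda>_. 0"]) auto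
qed (auto intro: mpoly_fun_add)

lemma mpoly_fun_mono:
  assumes "finite J" "d \<le> e" "mpoly_fun J d \<phi>"
  shows "mpoly_fun J e \<phi>"
proof -
  obtain c where c: "\<And>x. \<phi> x = (\<Sum>k\<in>exponents J d. c k * monomial_val J k x)"
    using assms by (auto simp: mpoly_fun_def)
  have "mpoly_fun J e (\<lambda>x. \<Sum>k\<in>exponents J d. c k * monomial_val J k x)"
    using assms exponents_mono[of d e J]
    by (intro mpoly_fun_sum mpoly_fun_cmonomial finite_exponents) auto
  then show ?thesis by (simp add: c[abs_def])
qed

lemma mpoly_fun_mult:
  assumes J: "finite J" and "mpoly_fun J d \<phi>" "mpoly_fun J e \<psi>"
  shows "mpoly_fun J (d + e) (\<lambda>x. \<phi> x * \<psi> x)"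
proof -
  obtain a b where a: "\<And>x. \<phi> x = (\<Sum>k\<in>exponents J d. a k * monomial_val J k x)"
    and b: "\<And>x. \<psi> x = (\<Sum>k\<in>exponents J e. b k * monomial_val J k x)"
    using assms by (auto simp: mpoly_fun_def)
  have "mpoly_fun J (d + e) (\<lambda>x. \<Sum>k\<in>exponents J d. \<Sum>l\<in>exponents J e.
      (a k * b l) * monomial_val J (\<lambda>j. k j + l j) x)"
    using J by (intro mpoly_fun_sum mpoly_fun_cmonomial finite_exponents)
      (auto simp: exponents_def sum.distrib intro: add_mono)
  also have "(\<lambda>x. \<Sum>k\<in>exponents J d. \<Sum>l\<in>exponents J e.
      (a k * b l) * monomial_val J (\<lambda>j. k j + l j) x) = (\<lambda>x. \<phi> x * \<psi> x)"
    by (simp add: a b sum_product monomial_val_def power_add prod.distrib mult_ac)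
  finally show ?thesis .
qed

lemma mpoly_fun_const: "finite J \<Longrightarrow> mpoly_fun J d (\<lambda>x. c)"
  using mpoly_fun_cmonomial[of J "\<lambda>_. 0" d c] by (simp add: exponents_def monomial_val_def)

lemma mpoly_fun_proj:
  assumes "finite J" "i \<in> J"
  shows "mpoly_fun J 1 (\<lambda>x. x i)"
proof -
  have "mpoly_fun J 1 (\<lambda>x. 1 * monomial_val J (\<lambda>j. if j = i then 1 else 0) x)"
    using assms by (intro mpoly_fun_cmonomial) (auto simp: exponents_def)
  also have "(\<lambda>x. 1 * monomial_val J (\<lambda>j. if j = i then 1 else 0) x) = (\<lambda>x. x i)"
    using assms by (simp add: monomial_val_def if_distrib[of "\<lambda>a. _ ^ a"] prod.delta cong: if_cong)
  finally show ?thesis .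
qed

text \<open>Passes from the coordinate-free filtration \<open>polyfun_le\<close> to explicit
  polynomials by pulling back along the linear map from coefficient vectors to \<open>W\<close>,
  under which linear forms stay linear forms.\<close>

lemma polyfun_le_mpoly_fun:
  fixes s :: "'k::comm_ring_1 \<Rightarrow> 'w::comm_monoid_add \<Rightarrow> 'w"
  assumes "polyfun_le s W d f" and J: "finite J"
    and zero: "0 \<in> W" "s 0 0 = 0"
    and closed: "\<And>x y. x \<in> W \<Longrightarrow> y \<in> W \<Longrightarrow> x + y \<in> W" "\<And>c x. x \<in> W \<Longrightarrow> s c x \<in> W"
    and E: "\<And>j. j \<in> J \<Longrightarrow> E j \<in> W"
  shows "mpoly_fun J d (\<lambda>a. f (\<Sum>j\<in>J. s (a j) (E j)))"
  using assms(1)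
proof (induction rule: polyfun_le.induct)
  case (linear f)
  have f0: "f 0 = 0" using linear zero unfolding linear_map_on_def by (metis mult_zero_left)
  have "(\<Sum>j\<in>S. s (a j) (E j)) \<in> W \<and> f (\<Sum>j\<in>S. s (a j) (E j)) = (\<Sum>j\<in>S. a j * f (E j))"
    if "S \<subseteq> J" for S a
    using finite_subset[OF that J] that
  proof (induction S rule: finite_induct)
    case empty
    then show ?case using f0 zero by simp
  next
    case (insert j S)
    then show ?case using linear E closed by (simp add: linear_map_on_def)
  qed
  then have "f (\<Sum>j\<in>J. s (a j) (E j)) = (\<Sum>j\<in>J. a j * f (E j))" for a by blast
  moreover have "mpoly_fun J 1 (\<lambda>a. \<Sum>j\<in>J. a j * f (E j))"
    using J mpoly_fun_mult[OF J mpoly_fun_proj[OF J] mpoly_fun_const[OF J, of 0]]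
    by (intro mpoly_fun_sum) auto
  ultimately show ?case by simp
qed (use J in \<open>auto intro: mpoly_fun_add mpoly_fun_mult mpoly_fun_mono mpoly_fun_const\<close>)

section \<open>Uniqueness of coefficients, orbit sums and translation invariance\<close>

lemma poly_eq_0_if_infinite_zeros:
  fixes P :: "'k::idom poly"
  assumes "infinite A" "\<And>x. x \<in> A \<Longrightarrow> poly P x = 0"
  shows "P = 0"
  using assms poly_roots_finite[of P] finite_subset[of A "{x. poly P x = 0}"] by blast

text \<open>Induction on the variables. With the others held fixed, the sum is a polynomial in the
  variable at \<open>i\<close> that vanishes on an infinite domain, so each of its coefficients
  \<open>C x m\<close> is zero.\<close>

lemma mpoly_coeffs_unique:
  fixes c :: "('i \<Rightarrow> nat) \<Rightarrow> 'k::idom"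
  assumes "infinite (UNIV :: 'k set)" "finite J" "finite K"
    and "\<And>k j. k \<in> K \<Longrightarrow> j \<notin> J \<Longrightarrow> k j = 0"
    and "\<And>x. (\<Sum>k\<in>K. c k * monomial_val J k x) = 0"
    and "k \<in> K"
  shows "c k = 0"
  using assms(2-)
proof (induction J arbitrary: K k c rule: finite_induct)
  case empty
  have "l j = k j" if "l \<in> K" for l j
    using that empty.prems(2)[of l j] empty.prems(2)[of k j] empty.prems(4) by simp
  then have "K = {k}" using empty.prems(4) by blast
  with empty.prems(3)[of undefined] show ?case by (simp add: monomial_val_def)
next
  case (insert i J)
  define C where "C x m = (\<Sum>l\<in>{l\<in>K. l i = m}. c l * monomial_val J l x)" for x m
  have C0: "C x m = 0" for x m
  proof -
    define P where "P = (\<Sum>l\<in>K. monom (c l * monomial_val J l x) (l i))"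
    have "poly P t = 0" for t
    proof -
      have "monomial_val J l (x(i := t)) = monomial_val J l x" for l
        using insert.hyps unfolding monomial_val_def by (intro prod.cong) auto
      then have "poly P t = (\<Sum>l\<in>K. c l * monomial_val (insert i J) l (x(i := t)))"
        using insert.hyps
        by (simp add: P_def poly_sum poly_monom monomial_val_def mult_ac)
      then show ?thesis using insert.prems(3) by simp
    qed
    then have "P = 0" using assms(1) poly_eq_0_if_infinite_zeros by blast
    then have "0 = coeff P m" by simp
    also have "\<dots> = C x m"
      using insert.prems(1) by (simp add: P_def C_def coeff_sum sum.inter_filter)
    finally show ?thesis by simp
  qed
  \<comment> \<open>Erasing the entry at \<open>i\<close> is injective on the slice
    \<open>l i = k i\<close> and leaves exponents supported in \<open>J\<close>, as the induction
    hypothesis requires.\<close>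
  define r where "r l = l(i := 0)" for l :: "'i \<Rightarrow> nat"
  define K' where "K' = r ` {l\<in>K. l i = k i}"
  have inj: "inj_on r {l\<in>K. l i = k i}"
    unfolding inj_on_def r_def by (metis (mono_tags, lifting) fun_upd_triv fun_upd_upd mem_Collect_eq)
  define c' where "c' l = c (l(i := k i))" for l
  have rk: "(r l)(i := k i) = l" if "l i = k i" for l
    using that by (auto simp: r_def fun_eq_iff)
  have "c' (r k) = 0"
  proof (rule insert.IH)
    show "finite K'" using insert.prems by (simp add: K'_def)
    show "l j = 0" if "l \<in> K'" "j \<notin> J" for l j
      using that insert.prems(2) by (auto simp: K'_def r_def)
    show "r k \<in> K'" using insert.prems by (simp add: K'_def)
    fix x :: "'i \<Rightarrow> 'k"
    have "monomial_val J (r l) x = monomial_val J l x" for l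
      using insert.hyps unfolding monomial_val_def r_def by (intro prod.cong) auto
    then have "(\<Sum>l\<in>K'. c' l * monomial_val J l x) = C x (k i)"
      unfolding K'_def C_def sum.reindex[OF inj] by (intro sum.cong) (auto simp: c'_def rk)
    then show "(\<Sum>l\<in>K'. c' l * monomial_val J l x) = 0" using C0 by simp
  qed
  then show ?case by (simp add: c'_def rk)
qed

text \<open>As \<open>p\<close> is prime and no point is fixed, every orbit of \<sigma> has exactly
  \<open>p\<close> elements and contributes \<open>p\<close> times a single value, which is zero.
  The induction removes one orbit \<open>O'\<close> at a time.\<close>

lemma sum_invariant_fixed_free_eq_0:
  fixes c :: "'a \<Rightarrow> 'k::semiring_1"
  assumes "finite X" "prime p" "of_nat p = (0 :: 'k)"
    and "\<And>x. x \<in> X \<Longrightarrow> \<sigma> x \<in> X" "\<And>x. x \<in> X \<Longrightarrow> (\<sigma> ^^ p) x = x"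
    and "\<And>x. x \<in> X \<Longrightarrow> c (\<sigma> x) = c x" "\<And>x. x \<in> X \<Longrightarrow> \<sigma> x \<noteq> x"
  shows "sum c X = 0"
  using assms(1,4-)
proof (induction X rule: finite_psubset_induct)
  case (psubset X)
  show ?case
  proof (cases "X = {}")
    case False
    then obtain x where x: "x \<in> X" by blast
    have it: "(\<sigma> ^^ i) x \<in> X" for i by (induction i) (auto simp: x psubset.prems)
    have cit: "c ((\<sigma> ^^ i) x) = c x" for i by (induction i) (auto simp: it psubset.prems)
    have fix_mult: "(\<sigma> ^^ (i * m)) x = x" if "(\<sigma> ^^ i) x = x" for i m
      by (induction m) (use that in \<open>auto simp: funpow_add\<close>)
    \<comment> \<open>\<open>i\<close> is invertible modulo \<open>p\<close>, so if the
      \<open>i\<close>-th iterate fixed \<open>x\<close>, then a multiple of \<open>i\<close> that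
      is \<open>1\<close> modulo \<open>p\<close> would show that \<sigma> itself fixes
      \<open>x\<close>.\<close>
    have no_fix: "(\<sigma> ^^ i) x \<noteq> x" if i: "0 < i" "i < p" for i
    proof
      assume fi: "(\<sigma> ^^ i) x = x"
      have "coprime i p"
        using that assms(2) by (meson coprime_commute nat_dvd_not_less prime_imp_coprime)
      then obtain a b where "i * a = p * b + 1"
        using i bezout_nat[of i p] by (auto simp: coprime_iff_gcd_eq_1)
      then have "(\<sigma> ^^ (p * b + 1)) x = x" using fix_mult[OF fi, of a] by simp
      moreover have "(\<sigma> ^^ (p * b + 1)) x = \<sigma> x"
        using fix_mult[of p b] psubset.prems(2)[OF x] by (simp)
      ultimately show False using psubset.prems(4)[OF x] by simp
    qed
    have inj: "inj_on (\<lambda>i. (\<sigma> ^^ i) x) {..<p}"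
    proof (rule linorder_inj_onI)
      fix i j assume "i < j" "i \<in> {..<p}" "j \<in> {..<p}"
      show "(\<sigma> ^^ i) x \<noteq> (\<sigma> ^^ j) x"
      proof
        assume "(\<sigma> ^^ i) x = (\<sigma> ^^ j) x"
        then have "(\<sigma> ^^ (p - j)) ((\<sigma> ^^ i) x) = (\<sigma> ^^ (p - j)) ((\<sigma> ^^ j) x)" by simp
        then have "(\<sigma> ^^ (p - j + i)) x = (\<sigma> ^^ (p - j + j)) x" by (simp add: funpow_add)
        then have "(\<sigma> ^^ (p - j + i)) x = x"
          using \<open>j \<in> {..<p}\<close> psubset.prems(2)[OF x] by simp
        moreover have "0 < p - j + i" "p - j + i < p" using \<open>i < j\<close> \<open>j \<in> {..<p}\<close> by auto
        ultimately show False using no_fix[of "p - j + i"] by metis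
      qed
    qed auto
    define O' where "O' = (\<lambda>i. (\<sigma> ^^ i) x) ` {..<p}"
    have OX: "O' \<subseteq> X" using it by (auto simp: O'_def)
    have p0: "p > 0" using assms(2) prime_gt_0_nat by blast
    have xO: "x \<in> O'" using p0 by (force simp: O'_def)
    \<comment> \<open>This makes the complement of the orbit stable: a point mapped into the orbit
      is recovered by applying \<sigma> another \<open>p - 1\<close> times.\<close>
    have pre: "y \<in> O'" if y: "y \<in> X" "\<sigma> y \<in> O'" for y
    proof -
      obtain i where i: "i < p" "\<sigma> y = (\<sigma> ^^ i) x" using y by (auto simp: O'_def)
      have "y = (\<sigma> ^^ (p - 1)) (\<sigma> y)"
        using psubset.prems(2)[OF \<open>y \<in> X\<close>] p0
        by (metis Suc_diff_1 comp_apply funpow_Suc_right)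
      also have "\<dots> = (\<sigma> ^^ (p - 1 + i)) x" using i(2) by (simp only: funpow_add comp_apply)
      also have "\<dots> \<in> O'"
      proof (cases "i = 0")
        case True
        then show ?thesis using p0 by (auto simp: O'_def)
      next
        case False
        then have "p - 1 + i = (i - 1) + p" using p0 by simp
        then have "(\<sigma> ^^ (p - 1 + i)) x = (\<sigma> ^^ (i - 1)) x"
          using psubset.prems(2)[OF x] by (simp add: funpow_add)
        then show ?thesis using i False by (auto simp: O'_def)
      qed
      finally show ?thesis .
    qed
    have "sum c O' = (\<Sum>i<p. c x)" unfolding O'_def by (simp add: sum.reindex[OF inj] cit)
    then have O0: "sum c O' = 0" using assms(3) by simp
    have "sum c (X - O') = 0"
    proof (rule psubset.IH)
      show "X - O' \<subset> X" using xO x by blast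
      show "\<sigma> y \<in> X - O'" if "y \<in> X - O'" for y
        using that pre psubset.prems(1) by blast
    qed (use psubset.prems in auto)
    then show ?thesis using O0 sum.subset_diff[OF OX psubset.hyps(1), of c] by simp
  qed simp
qed

lemma sum_invariant_eq_sum_fixed:
  fixes c :: "'a \<Rightarrow> 'k::semiring_1"
  assumes "finite X" "prime p" "of_nat p = (0 :: 'k)"
    and "\<And>x. x \<in> X \<Longrightarrow> \<sigma> x \<in> X" "\<And>x. x \<in> X \<Longrightarrow> (\<sigma> ^^ p) x = x"
    and "\<And>x. x \<in> X \<Longrightarrow> c (\<sigma> x) = c x"
  shows "sum c X = sum c {x \<in> X. \<sigma> x = x}"
proof -
  let ?F = "{x \<in> X. \<sigma> x = x}"
  have "sum c (X - ?F) = 0"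
  proof (rule sum_invariant_fixed_free_eq_0[OF _ assms(2,3)])
    show "\<sigma> x \<in> X - ?F" if "x \<in> X - ?F" for x
    proof -
      \<comment> \<open>A point whose image is fixed is fixed: all its positive iterates coincide,
        and the \<open>p\<close>-th one is the point itself.\<close>
      have "\<sigma> (\<sigma> x) \<noteq> \<sigma> x"
      proof
        assume h: "\<sigma> (\<sigma> x) = \<sigma> x"
        have "(\<sigma> ^^ Suc i) x = \<sigma> x" for i by (induction i) (auto simp: h)
        from this[of "p - 1"] have "(\<sigma> ^^ p) x = \<sigma> x"
          using assms(2) prime_gt_0_nat[of p] by simp
        then show False using that assms(5) by auto
      qed
      then show ?thesis using that assms(4) by auto
    qed
  qed (use assms in auto)
  then show ?thesis using sum.subset_diff[of ?F X c] assms(1) by simp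
qed

text \<open>Orbits of length divisible by \<open>p\<close> contribute nothing to the sum of the coefficients, and the
  exponents fixed by all translations are constant, hence of degree divisible by \<open>card E\<close>.\<close>

lemma translation_invariant_mpoly_fun_at_1:
  fixes \<phi> :: "('k::idom \<Rightarrow> 'k) \<Rightarrow> 'k" and E :: "'k set"
  assumes inf: "infinite (UNIV :: 'k set)" and char: "CHAR('k) = p" "p > 0"
    and E: "finite E" "0 \<in> E" "\<And>a b. a \<in> E \<Longrightarrow> b \<in> E \<Longrightarrow> a + b \<in> E"
      "\<And>a. a \<in> E \<Longrightarrow> - a \<in> E"
    and \<phi>: "mpoly_fun E d \<phi>" and d: "d < card E"
    and inv: "\<And>x t. t \<in> E \<Longrightarrow> \<phi> (\<lambda>a. x (a + t)) = \<phi> x"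
  shows "\<phi> (\<lambda>_. 1) = \<phi> (\<lambda>_. 0)"
proof -
  have p: "prime p" "of_nat p = (0 :: 'k)"
    using char prime_CHAR_semidom by (auto simp flip: char(1))
  obtain c where c: "\<And>x. \<phi> x = (\<Sum>k\<in>exponents E d. c k * monomial_val E k x)"
    using \<phi> by (auto simp: mpoly_fun_def)
  let ?X = "exponents E d"
  have finX: "finite ?X" using E finite_exponents by blast
  define \<tau> where "\<tau> t k = (\<lambda>a. k (a + t))" for t :: 'k and k :: "'k \<Rightarrow> nat"
  have bijE: "bij_betw (\<lambda>a. a + t) E E" if "t \<in> E" for t
    using that E by (intro bij_betwI[where g = "\<lambda>a. a - t"]) (auto simp: diff_conv_add_uminus simp del: add_uminus_conv_diff)
  have \<tau>X: "\<tau> t k \<in> ?X" if "t \<in> E" "k \<in> ?X" for t k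
  proof -
    have "sum (\<tau> t k) E = sum k E"
      unfolding \<tau>_def using sum.reindex_bij_betw[OF bijE[OF that(1)]] .
    moreover have "k (a + t) = 0" if "a \<notin> E" for a
    proof -
      have "a + t \<notin> E"
      proof
        assume "a + t \<in> E"
        then have "a + t + - t \<in> E" using E \<open>t \<in> E\<close> by blast
        then show False using that by simp
      qed
      then show ?thesis using \<open>k \<in> ?X\<close> by (auto simp: exponents_def)
    qed
    ultimately show ?thesis using that by (auto simp: exponents_def \<tau>_def)
  qed
  have \<tau>\<tau>: "\<tau> s (\<tau> t k) = \<tau> (s + t) k" for s t k
    by (auto simp: \<tau>_def fun_eq_iff add_ac)
  have bijX: "bij_betw (\<tau> t) ?X ?X" if "t \<in> E" for t
    using that E \<tau>X[of t] \<tau>X[of "- t"]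
    by (intro bij_betwI[where g = "\<tau> (- t)"]) (auto simp: \<tau>\<tau>, auto simp: \<tau>_def)
  \<comment> \<open>Translating the variables permutes the monomials, so uniqueness of coefficients
    turns the invariance of \<phi> into invariance of \<open>c\<close>.\<close>
  have c\<tau>: "c (\<tau> t k) = c k" if t: "t \<in> E" and k: "k \<in> ?X" for t k
  proof -
    { fix x
      have "\<phi> x = (\<Sum>k\<in>?X. c (\<tau> t k) * monomial_val E (\<tau> t k) x)"
        unfolding c using sum.reindex_bij_betw[OF bijX[OF t], symmetric] .
      also have "\<dots> = (\<Sum>k\<in>?X. c (\<tau> t k) * monomial_val E k (\<lambda>a. x (a - t)))"
      proof (intro sum.cong refl arg_cong2[where f = "(*)"])
        fix k
        show "monomial_val E (\<tau> t k) x = monomial_val E k (\<lambda>a. x (a - t))"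
          unfolding monomial_val_def \<tau>_def
          using prod.reindex_bij_betw[OF bijE[OF t], of "\<lambda>a. x (a - t) ^ k a"] by simp
      qed
      finally have "\<phi> x = (\<Sum>k\<in>?X. c (\<tau> t k) * monomial_val E k (\<lambda>a. x (a - t)))" .
    } note 1 = this
    have "c (\<tau> t k) - c k = 0"
    proof (rule mpoly_coeffs_unique[OF inf E(1) finX, of "\<lambda>k. c (\<tau> t k) - c k"])
      fix x
      have "(\<Sum>k\<in>?X. c (\<tau> t k) * monomial_val E k x) = \<phi> (\<lambda>a. x (a + t))"
        using 1[of "\<lambda>a. x (a + t)"] by simp
      also have "\<dots> = (\<Sum>k\<in>?X. c k * monomial_val E k x)"
        using inv[OF t, of x] c by simp
      finally show "(\<Sum>k\<in>?X. (c (\<tau> t k) - c k) * monomial_val E k x) = 0"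
        by (simp add: left_diff_distrib sum_subtractf)
    qed (use k in \<open>auto simp: exponents_def\<close>)
    then show ?thesis by simp
  qed
  \<comment> \<open>Translations are imposed one at a time: the \<open>p\<close>-th power of each
    \<open>\<tau> t\<close> is the identity, and since translations commute it preserves the
    exponents fixed by the earlier ones.\<close>
  have "sum c ?X = sum c {k\<in>?X. \<forall>t\<in>S. \<tau> t k = k}" if "S \<subseteq> E" for S
    using finite_subset[OF that E(1)] that
  proof (induction S rule: finite_induct)
    case (insert t S)
    let ?Y = "{k\<in>?X. \<forall>t\<in>S. \<tau> t k = k}"
    have "sum c ?X = sum c ?Y" using insert by simp
    also have "\<dots> = sum c {k\<in>?Y. \<tau> t k = k}"
    proof (rule sum_invariant_eq_sum_fixed[OF _ p])
      show "\<tau> t k \<in> ?Y" if "k \<in> ?Y" for k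
        using that \<tau>X[of t k] insert.prems by (auto simp: \<tau>\<tau>) (metis \<tau>\<tau> add.commute)
      have "(\<tau> t ^^ m) k = \<tau> (of_nat m * t) k" for m k
        by (induction m) (simp_all add: \<tau>\<tau> algebra_simps, simp add: \<tau>_def)
      then show "(\<tau> t ^^ p) k = k" for k using p by (simp add: \<tau>_def)
    qed (use finX c\<tau> insert.prems in auto)
    also have "{k\<in>?Y. \<tau> t k = k} = {k\<in>?X. \<forall>t\<in>insert t S. \<tau> t k = k}" by auto
    finally show ?case .
  qed simp
  then have sumE: "sum c ?X = sum c {k\<in>?X. \<forall>t\<in>E. \<tau> t k = k}" by blast
  have fixed: "{k\<in>?X. \<forall>t\<in>E. \<tau> t k = k} = {\<lambda>_. 0}"
  proof (intro equalityI subsetI)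
    fix k assume k: "k \<in> {k\<in>?X. \<forall>t\<in>E. \<tau> t k = k}"
    have kE: "k t = k 0" if "t \<in> E" for t
      using k that by (auto simp: \<tau>_def fun_eq_iff) (metis add_0)
    then have "sum k E = card E * k 0" by simp
    moreover have "sum k E \<le> d" using k by (simp add: exponents_def)
    ultimately have "card E * k 0 < card E * 1" using d by linarith
    then have "k 0 = 0" by (simp only: mult_less_cancel1) simp
    then show "k \<in> {\<lambda>_. 0}" using k kE by (auto simp: exponents_def)
  qed (auto simp: \<tau>_def exponents_def)
  have "\<phi> (\<lambda>_. 1) = sum c ?X" unfolding c by (simp add: monomial_val_def)
  also have "\<dots> = c (\<lambda>_. 0)" using sumE fixed by simp
  also have "\<dots> = \<phi> (\<lambda>_. 0)"
  proof -
    have "monomial_val E k (\<lambda>_. 0) = (if k = (\<lambda>_. 0) then 1 else (0::'k))" if "k \<in> ?X" for k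
      using that E(1) by (auto simp: monomial_val_def exponents_def fun_eq_iff power_0_left)
    then have "\<phi> (\<lambda>_. 0) = (\<Sum>k\<in>?X. if k = (\<lambda>_. 0) then c k else 0)"
      unfolding c by (intro sum.cong) auto
    also have "\<dots> = c (\<lambda>_. 0)" using finX by (simp add: exponents_def)
    finally show ?thesis by simp
  qed
  finally show ?thesis .
qed

subsection \<open>Finite subfields\<close>

text \<open>Compares coefficients in \<open>(X + 1) ^ q = X ^ q + 1\<close> for \<open>q\<close> a
  power of the characteristic.\<close>

lemma of_nat_prime_power_choose_eq_0:
  fixes i n :: nat
  assumes "prime CHAR('k::comm_ring_1)" "0 < i" "i < CHAR('k) ^ n"
  shows "of_nat (CHAR('k) ^ n choose i) = (0 :: 'k)"
proof -
  let ?q = "CHAR('k) ^ n"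
  have "([:1, 1:] :: 'k poly) = [:0, 1:] + 1" by (simp add: one_pCons)
  then have "([:1, 1:] :: 'k poly) ^ ?q = monom 1 ?q + 1"
    using freshmans_dream'[of ?q n "[:0, 1:] :: 'k poly" 1] assms(1)
    by (simp add: monom_altdef)
  then show ?thesis
    using assms coeff_linear_poly_power[of i ?q "1 :: 'k" 1] by (simp add: coeff_1)
qed

text \<open>Pascal's rule: neighbouring entries of row \<open>q - 1\<close> add up to an interior
  entry of row \<open>q\<close>, which is zero, so the entries alternate in sign starting from
  \<open>1\<close>.\<close>

lemma of_nat_pred_prime_power_choose:
  assumes "prime CHAR('k::comm_ring_1)" "i < CHAR('k) ^ n"
  shows "of_nat ((CHAR('k) ^ n - 1) choose i) = ((- 1) ^ i :: 'k)"
  using assms(2)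
proof (induction i)
  case (Suc i)
  have "CHAR('k) ^ n = Suc (CHAR('k) ^ n - 1)" using Suc.prems by simp
  then have "CHAR('k) ^ n choose Suc i
      = ((CHAR('k) ^ n - 1) choose i) + ((CHAR('k) ^ n - 1) choose Suc i)"
    by (metis binomial_Suc_Suc)
  then have "(0 :: 'k) = of_nat ((CHAR('k) ^ n - 1) choose i) + of_nat ((CHAR('k) ^ n - 1) choose Suc i)"
    using of_nat_prime_power_choose_eq_0[OF assms(1), of "Suc i" n] Suc.prems
    by (metis of_nat_add zero_less_Suc)
  then show ?case using Suc by (simp add: eq_neg_iff_add_eq_0 add.commute)
qed simp

text \<open>Over an algebraically closed field, with \<open>q\<close> a positive power of the prime
  characteristic, this is the subfield with \<open>q\<close> elements.\<close>

definition frob_fixed :: "nat \<Rightarrow> 'k::monoid_mult set" where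
  "frob_fixed q = {a. a ^ q = a}"

text \<open>A repeated factor in the splitting into linear factors would give a common root with the
  derivative, so all multiplicities are one.\<close>

lemma card_roots_eq_degree:
  fixes P :: "'k::alg_closed_field poly"
  assumes "P \<noteq> 0" "\<And>x. poly P x = 0 \<Longrightarrow> poly (pderiv P) x \<noteq> 0"
  shows "card {x. poly P x = 0} = degree P"
proof -
  obtain A where A: "size A = degree P" "P = Polynomial.smult (lead_coeff P) (\<Prod>x\<in>#A. [:-x, 1:])"
    using alg_closed_imp_factorization[OF assms(1)] by blast
  have count: "count A x = 1" if x: "x \<in># A" for x
  proof (rule ccontr)
    assume "count A x \<noteq> 1"
    moreover obtain B where B: "A = add_mset x B" using x by (metis multi_member_split)
    ultimately have "x \<in># B" by (auto simp: count_eq_zero_iff)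
    then obtain C where C: "B = add_mset x C" by (metis multi_member_split)
    define R where "R = Polynomial.smult (lead_coeff P) (\<Prod>x\<in>#C. [:-x, 1:])"
    have P: "P = [:-x, 1:] * ([:-x, 1:] * R)"
      by (subst A(2)) (simp add: B C R_def)
    then have "poly P x = 0" by simp
    moreover have "poly (pderiv P) x = 0" unfolding P by (simp only: pderiv_mult) simp
    ultimately show False using assms(2) by blast
  qed
  have "poly P x = 0 \<longleftrightarrow> x \<in># A" for x
  proof -
    have "poly P x = lead_coeff P * poly (\<Prod>y\<in>#A. [:-y, 1:]) x"
      using arg_cong[OF A(2), of "\<lambda>p. poly p x"] by (simp only: poly_smult)
    then show ?thesis
      using assms(1) by (auto simp: poly_prod_mset prod_mset_zero_iff)
  qed
  then have "{x. poly P x = 0} = set_mset A" by blast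
  then have "card {x. poly P x = 0} = size A"
    by (simp add: size_multiset_overloaded_eq count)
  then show ?thesis using A by simp
qed

text \<open>The elements are the roots of \<open>X ^ q - X\<close>, whose derivative is the constant
  \<open>-1\<close> because \<open>q\<close> is zero in the field. The condition
  \<open>n > 0\<close> excludes \<open>q = 1\<close>, where every element is fixed.\<close>

lemma frob_fixed_facts:
  fixes n :: nat
  assumes "prime CHAR('k::alg_closed_field)" "n > 0"
  shows card_frob_fixed: "card (frob_fixed (CHAR('k) ^ n) :: 'k set) = CHAR('k) ^ n"
    and finite_frob_fixed: "finite (frob_fixed (CHAR('k) ^ n) :: 'k set)"
proof -
  let ?q = "CHAR('k) ^ n"
  define P :: "'k poly" where "P = monom 1 ?q - monom 1 1"
  have q1: "?q > 1" using assms by (metis one_less_power prime_gt_1_nat)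
  have "degree P = ?q"
    unfolding P_def diff_conv_add_uminus
    by (subst degree_add_eq_left) (use q1 in \<open>auto simp: degree_monom_eq\<close>)
  moreover have "pderiv P = - 1"
    using assms by (simp add: P_def pderiv_diff pderiv_monom monom_0 one_pCons zero_power)
  moreover have "P \<noteq> 0" using calculation q1 by auto
  moreover have E: "frob_fixed ?q = {x. poly P x = 0}"
    by (auto simp: frob_fixed_def P_def poly_monom)
  ultimately show "card (frob_fixed ?q :: 'k set) = ?q"
    using card_roots_eq_degree[of P] by simp
  then show "finite (frob_fixed ?q :: 'k set)" using q1 by (metis card.infinite not_less_zero)
qed

lemma frob_fixed_subgroup:
  fixes a b :: "'k::idom"
  assumes "prime CHAR('k)"
  shows "(0 :: 'k) \<in> frob_fixed (CHAR('k) ^ n)"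
    and "a \<in> frob_fixed (CHAR('k) ^ n) \<Longrightarrow> b \<in> frob_fixed (CHAR('k) ^ n) \<Longrightarrow>
      a + b \<in> frob_fixed (CHAR('k) ^ n)"
    and "a \<in> frob_fixed (CHAR('k) ^ n) \<Longrightarrow> - a \<in> frob_fixed (CHAR('k) ^ n)"
proof -
  show 0: "(0 :: 'k) \<in> frob_fixed (CHAR('k) ^ n)"
    using assms by (auto simp: frob_fixed_def power_0_left)
  show add: "a \<in> frob_fixed (CHAR('k) ^ n) \<Longrightarrow> b \<in> frob_fixed (CHAR('k) ^ n) \<Longrightarrow>
      a + b \<in> frob_fixed (CHAR('k) ^ n)"
    using freshmans_dream'[OF assms refl, of a b n] by (simp add: frob_fixed_def)
  show "- a \<in> frob_fixed (CHAR('k) ^ n)" if "a \<in> frob_fixed (CHAR('k) ^ n)"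
  proof -
    have "a + (- a) ^ (CHAR('k) ^ n) = (a + - a) ^ (CHAR('k) ^ n)"
      using freshmans_dream'[OF assms refl, of a "- a" n] that by (simp add: frob_fixed_def)
    then show ?thesis using 0 by (simp add: frob_fixed_def eq_neg_iff_add_eq_0 add.commute)
  qed
qed

text \<open>The range of \<open>m\<close> covers the exponents in the entries of
  \<open>upper_conj\<close>. For \<open>0 < m < q - 1\<close>, multiplication by a suitable
  \<open>b\<close> rescales the sum by a factor other than \<open>1\<close>; at
  \<open>m = q - 1\<close> each of the \<open>q - 1\<close> nonzero elements contributes
  \<open>1\<close>.\<close>

lemma power_sum_frob_fixed:
  fixes n m :: nat
  assumes char: "prime CHAR('k::alg_closed_field)" "n > 0" and m: "m \<le> 2 * (CHAR('k) ^ n - 1)"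
  shows "(\<Sum>a\<in>frob_fixed (CHAR('k) ^ n). a ^ m)
    = (if m = CHAR('k) ^ n - 1 \<or> m = 2 * (CHAR('k) ^ n - 1) then - 1 else 0 :: 'k)"
proof -
  define q where "q = CHAR('k) ^ n"
  let ?E = "frob_fixed q :: 'k set"
  have q1: "q > 1" using char unfolding q_def by (metis one_less_power prime_gt_1_nat)
  have q0: "of_nat q = (0 :: 'k)" using char by (simp add: q_def)
  have fin: "finite ?E" and card: "card ?E = q"
    using finite_frob_fixed card_frob_fixed char by (auto simp: q_def)
  have pow: "a ^ (q - 1) = 1" if "a \<in> ?E" "a \<noteq> 0" for a
  proof -
    have "a * a ^ (q - 1) = a * 1"
      using that q1 by (simp add: frob_fixed_def flip: power_Suc)
    then show ?thesis using that by simp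
  qed
  have zero: "0 \<in> ?E" using q1 by (simp add: frob_fixed_def)
  have low: "(\<Sum>a\<in>?E. a ^ m) = 0" if "m < q - 1" for m
  proof (cases "m = 0")
    case True
    then show ?thesis using card q0 by simp
  next
    case False
    \<comment> \<open>Otherwise the \<open>q - 1\<close> nonzero elements would all be roots of
      \<open>X ^ m - 1\<close>, more than its degree allows.\<close>
    have "\<exists>b\<in>?E. b \<noteq> 0 \<and> b ^ m \<noteq> 1"
    proof (rule ccontr)
      assume "\<not> ?thesis"
      then have sub: "?E - {0} \<subseteq> {x. poly (monom 1 m - 1) x = 0}" by (auto simp: poly_monom)
      have deg: "degree (monom 1 m - 1 :: 'k poly) \<le> m"
        by (intro degree_diff_le) (auto simp: degree_monom_le)
      have ne: "(monom 1 m - 1 :: 'k poly) \<noteq> 0"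
        using False by (metis degree_1 degree_monom_eq eq_iff_diff_eq_0 one_neq_zero)
      have "q - 1 = card (?E - {0})" using fin zero card by simp
      also have "\<dots> \<le> card {x. poly (monom 1 m - 1 :: 'k poly) x = 0}"
        using sub ne by (intro card_mono poly_roots_finite)
      also have "\<dots> \<le> m" using card_poly_roots_bound[OF ne] deg by linarith
      finally show False using that by simp
    qed
    then obtain b where b: "b \<in> ?E" "b \<noteq> 0" "b ^ m \<noteq> 1" by blast
    have "bij_betw (\<lambda>a. b * a) ?E ?E"
      using b by (intro bij_betwI[where g = "\<lambda>a. a / b"])
        (auto simp: frob_fixed_def power_mult_distrib power_divide)
    then have "(\<Sum>a\<in>?E. a ^ m) = (\<Sum>a\<in>?E. (b * a) ^ m)"
      by (rule sum.reindex_bij_betw[symmetric])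
    then have "(\<Sum>a\<in>?E. a ^ m) = b ^ m * (\<Sum>a\<in>?E. a ^ m)"
      by (simp add: power_mult_distrib flip: sum_distrib_left)
    then have "(1 - b ^ m) * (\<Sum>a\<in>?E. a ^ m) = 0"
      by (simp add: left_diff_distrib)
    then show ?thesis using b by simp
  qed
  have top: "(\<Sum>a\<in>?E. a ^ (q - 1)) = - 1"
  proof -
    have "(\<Sum>a\<in>?E. a ^ (q - 1)) = (\<Sum>a\<in>?E - {0}. a ^ (q - 1))"
      using fin q1 by (intro sum.mono_neutral_right) auto
    also have "\<dots> = (\<Sum>a\<in>?E - {0}. 1)" by (intro sum.cong) (auto simp: pow[unfolded One_nat_def])
    also have "\<dots> = of_nat (q - 1)" using fin zero card by simp
    also have "\<dots> = - 1" using q0 q1 by (simp add: of_nat_diff)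
    finally show ?thesis .
  qed
  \<comment> \<open>Nonzero elements satisfy \<open>a ^ (q - 1) = 1\<close>; for
    \<open>a = 0\<close> both exponents are still positive, so both powers vanish.\<close>
  have red: "(\<Sum>a\<in>?E. a ^ m) = (\<Sum>a\<in>?E. a ^ (m - (q - 1)))" if "m > q - 1" for m
  proof (intro sum.cong refl)
    fix a assume a: "a \<in> ?E"
    show "a ^ m = a ^ (m - (q - 1))"
    proof (cases "a = 0")
      case False
      have "a ^ m = a ^ (m - (q - 1)) * a ^ (q - 1)" using that by (simp flip: power_add)
      then show ?thesis using pow[OF a False] by simp
    qed (use that q1 in \<open>auto simp: power_0_left\<close>)
  qed
  consider "m < q - 1" | "m = q - 1" | "m > q - 1" "m < 2 * (q - 1)" | "m > q - 1" "m = 2 * (q - 1)"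
    using m q1 unfolding q_def[symmetric] by linarith
  then have "(\<Sum>a\<in>?E. a ^ m) = (if m = q - 1 \<or> m = 2 * (q - 1) then - 1 else 0)"
  proof cases
    case 3
    then have "m - (q - 1) < q - 1" by linarith
    then show ?thesis using red[of m] low[of "m - (q - 1)"] 3 by simp
  next
    case 4
    then have "m - (q - 1) = q - 1" by linarith
    then have "(\<Sum>a\<in>?E. a ^ m) = - 1" unfolding red[OF 4(1)] using top by (simp only:)
    then show ?thesis using 4(2) by simp
  qed (use low top in auto)
  then show ?thesis unfolding q_def .
qed

subsection \<open>Symmetric powers as matrix representations\<close>

text \<open>For a ring homomorphism \<iota> this is the map out of \<open>S(V)\<close> given by its
  universal property. It is used both for \<open>sym_action g\<close> and for the dehomogenization
  \<open>dehom\<close>.\<close>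

definition sym_eval :: "('k \<Rightarrow> 'r) \<Rightarrow> (2 \<Rightarrow> 'r) \<Rightarrow> 'k::field symalg \<Rightarrow> 'r::comm_ring_1" where
  "sym_eval \<iota> \<phi> P = (\<Sum>m\<in>Poly_Mapping.keys P. \<iota> (Poly_Mapping.lookup P m) *
     (\<Prod>j\<in>UNIV. \<phi> j ^ Poly_Mapping.lookup m j))"

locale scalar_hom =
  fixes \<iota> :: "'k::field \<Rightarrow> 'r::comm_ring_1"
  assumes hom_add: "\<iota> (a + b) = \<iota> a + \<iota> b"
    and hom_mult: "\<iota> (a * b) = \<iota> a * \<iota> b"
    and hom_one: "\<iota> 1 = 1"
begin

lemma hom_zero: "\<iota> 0 = 0"
  using hom_add[of 0 0] by simp

lemma sym_eval_superset:
  assumes "finite S" "Poly_Mapping.keys P \<subseteq> S"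
  shows "sym_eval \<iota> \<phi> P = (\<Sum>m\<in>S. \<iota> (Poly_Mapping.lookup P m) *
     (\<Prod>j\<in>UNIV. \<phi> j ^ Poly_Mapping.lookup m j))"
  unfolding sym_eval_def using assms
  by (intro sum.mono_neutral_left) (auto simp: hom_zero in_keys_iff)

lemma sym_eval_single: "sym_eval \<iota> \<phi> (Poly_Mapping.single m c)
    = \<iota> c * (\<Prod>j\<in>UNIV. \<phi> j ^ Poly_Mapping.lookup m j)"
  by (subst sym_eval_superset[of "{m}"]) auto

lemma sym_eval_add: "sym_eval \<iota> \<phi> (P + Q) = sym_eval \<iota> \<phi> P + sym_eval \<iota> \<phi> Q"
  by (subst (1 2 3) sym_eval_superset[of "Poly_Mapping.keys P \<union> Poly_Mapping.keys Q"])
    (auto simp: keys_add lookup_add hom_add algebra_simps sum.distrib intro: subsetD[OF keys_add])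

lemma sym_eval_0: "sym_eval \<iota> \<phi> 0 = 0"
  by (simp add: sym_eval_def)

lemma sym_eval_sum: "sym_eval \<iota> \<phi> (\<Sum>i\<in>I. P i) = (\<Sum>i\<in>I. sym_eval \<iota> \<phi> (P i))"
  by (induction I rule: infinite_finite_induct) (auto simp: sym_eval_add sym_eval_0)

end

lemma sum_single_keys:
  "(\<Sum>m\<in>Poly_Mapping.keys P. Poly_Mapping.single m (Poly_Mapping.lookup P m)) = P"
  by (rule poly_mapping_eqI) (auto simp: lookup_sum lookup_single when_def in_keys_iff)

context scalar_hom
begin

lemma sym_eval_mult: "sym_eval \<iota> \<phi> (P * Q) = sym_eval \<iota> \<phi> P * sym_eval \<iota> \<phi> Q"
proof -
  have "sym_eval \<iota> \<phi> (P * Q) = sym_eval \<iota> \<phi> ((\<Sum>m\<in>Poly_Mapping.keys P. Poly_Mapping.single m (Poly_Mapping.lookup P m)) *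
      (\<Sum>m\<in>Poly_Mapping.keys Q. Poly_Mapping.single m (Poly_Mapping.lookup Q m)))"
    by (simp only: sum_single_keys)
  also have "\<dots> = sym_eval \<iota> \<phi> P * sym_eval \<iota> \<phi> Q"
    unfolding sym_eval_def[of \<iota> \<phi> P] sym_eval_def[of \<iota> \<phi> Q]
    by (simp add: sum_product sym_eval_sum mult_single sym_eval_single hom_mult lookup_add power_add
        prod.distrib mult_ac)
  finally show ?thesis .
qed

lemma sym_eval_1: "sym_eval \<iota> \<phi> 1 = 1"
  using sym_eval_single[of \<phi> 0 1] by (simp add: hom_one)

lemma sym_eval_power: "sym_eval \<iota> \<phi> (P ^ n) = sym_eval \<iota> \<phi> P ^ n"
  by (induction n) (auto simp: sym_eval_1 sym_eval_mult)

lemma sym_eval_prod: "sym_eval \<iota> \<phi> (\<Prod>i\<in>I. P i) = (\<Prod>i\<in>I. sym_eval \<iota> \<phi> (P i))"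
  by (induction I rule: infinite_finite_induct) (auto simp: sym_eval_1 sym_eval_mult)

lemma sym_eval_const: "sym_eval \<iota> \<phi> (sym_const c) = \<iota> c"
  by (simp add: sym_const_def sym_eval_single)

lemma sym_eval_gen: "sym_eval \<iota> \<phi> (sym_gen i) = \<phi> i"
proof -
  have "(\<Prod>j\<in>UNIV. \<phi> j ^ Poly_Mapping.lookup (Poly_Mapping.single i (1::nat)) j)
      = (\<Prod>j\<in>UNIV. if i = j then \<phi> j else 1)"
    by (intro prod.cong) (auto simp: lookup_single when_def)
  then show ?thesis by (simp add: sym_gen_def sym_eval_single hom_one)
qed

end

definition lin_form :: "'k::field ^ 2 ^ 2 \<Rightarrow> 2 \<Rightarrow> 'k symalg" where
  "lin_form g j = (\<Sum>i\<in>UNIV. sym_const (g $ i $ j) * sym_gen i)"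

lemma sym_action_sym_eval: "sym_action g = sym_eval sym_const (lin_form g)"
  by (simp add: fun_eq_iff sym_action_def sym_eval_def lin_form_def)

lemma sym_const_hom: "scalar_hom sym_const"
  by unfold_locales (simp_all add: sym_const_def single_add mult_single)

interpretation sym: scalar_hom sym_const
  by (rule sym_const_hom)

lemma sym_action_lin_form: "sym_action g (lin_form h j) = lin_form (g ** h) j"
proof -
  have "sym_action g (lin_form h j) = (\<Sum>i\<in>UNIV. sym_const (h $ i $ j) * lin_form g i)"
    unfolding sym_action_sym_eval
    by (subst lin_form_def) (simp add: sym.sym_eval_sum sym.sym_eval_mult sym.sym_eval_const sym.sym_eval_gen)
  also have "\<dots> = (\<Sum>i\<in>UNIV. \<Sum>l\<in>UNIV. sym_const (g $ l $ i * h $ i $ j) * sym_gen l)"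
    by (simp add: lin_form_def sum_distrib_left sym.hom_mult mult_ac)
  also have "\<dots> = lin_form (g ** h) j"
    unfolding lin_form_def
    by (subst sum.swap) (simp add: matrix_matrix_mult_def sum_2 sym.hom_add distrib_right)
  finally show ?thesis .
qed

text \<open>Both sides come from algebra endomorphisms, which agree on the generators by
  \<open>sym_action_lin_form\<close>.\<close>

lemma sym_action_mult: "sym_action (g ** h) P = sym_action g (sym_action h P)"
proof -
  have "sym_action g (sym_action h P) = (\<Sum>m\<in>Poly_Mapping.keys P. sym_const (Poly_Mapping.lookup P m) *
     (\<Prod>j\<in>UNIV. sym_action g (lin_form h j) ^ Poly_Mapping.lookup m j))"
    unfolding sym_action_sym_eval
    by (subst (2) sym_eval_def) (simp add: sym.sym_eval_sum sym.sym_eval_mult sym.sym_eval_const sym.sym_eval_prod sym.sym_eval_power)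
  then show ?thesis by (simp add: sym_action_lin_form) (simp add: sym_action_sym_eval sym_eval_def)
qed

definition homog :: "nat \<Rightarrow> 'k::field symalg set" where
  "homog N = {P. \<forall>m\<in>Poly_Mapping.keys P. (\<Sum>j\<in>UNIV. Poly_Mapping.lookup m j) = N}"

definition basis_exponent :: "nat \<Rightarrow> nat \<Rightarrow> 2 \<Rightarrow>\<^sub>0 nat" where
  "basis_exponent N i = Poly_Mapping.single 1 (N - i) + Poly_Mapping.single 2 i"

definition sym_basis :: "nat \<Rightarrow> nat \<Rightarrow> 'k::field symalg" where
  "sym_basis N i = Poly_Mapping.single (basis_exponent N i) 1"

lemma lookup_basis_exponent: "Poly_Mapping.lookup (basis_exponent N i) 1 = N - i" "Poly_Mapping.lookup (basis_exponent N i) 2 = i"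
  by (auto simp: basis_exponent_def lookup_add lookup_single when_def)

lemma basis_exponent_inj: "basis_exponent N i = basis_exponent N j \<longleftrightarrow> i = j"
  by (metis lookup_basis_exponent(2))

lemma basis_exponent_lookup:
  assumes "(\<Sum>j\<in>UNIV. Poly_Mapping.lookup m j) = N"
  shows "m = basis_exponent N (Poly_Mapping.lookup m 2)" "Poly_Mapping.lookup m 2 \<le> N"
proof -
  have s: "Poly_Mapping.lookup m 1 + Poly_Mapping.lookup m 2 = N" using assms by (simp add: sum_2)
  show "m = basis_exponent N (Poly_Mapping.lookup m 2)"
  proof (rule poly_mapping_eqI)
    fix k :: 2
    consider "k = 1" | "k = 2" using exhaust_2 by blast
    then show "Poly_Mapping.lookup m k = Poly_Mapping.lookup (basis_exponent N (Poly_Mapping.lookup m 2)) k"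
      using s by cases (simp_all add: lookup_basis_exponent)
  qed
  show "Poly_Mapping.lookup m 2 \<le> N" using s by simp
qed

lemma homog_0: "0 \<in> homog N"
  by (simp add: homog_def)

lemma homog_add: "P \<in> homog N \<Longrightarrow> Q \<in> homog N \<Longrightarrow> P + Q \<in> homog N"
  using keys_add[of P Q] by (auto simp: homog_def)

lemma homog_sum: "(\<And>i. i \<in> I \<Longrightarrow> P i \<in> homog N) \<Longrightarrow> (\<Sum>i\<in>I. P i) \<in> homog N"
  by (induction I rule: infinite_finite_induct) (auto intro: homog_add homog_0)

lemma homog_mult:
  assumes "P \<in> homog M" "Q \<in> homog N"
  shows "P * Q \<in> homog (M + N)"
  using assms keys_mult[of P Q] by (auto simp: homog_def lookup_add sum.distrib)

lemma homog_const: "sym_const c \<in> homog 0"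
  by (simp add: homog_def sym_const_def)

lemma homog_scale: "P \<in> homog N \<Longrightarrow> sym_const c * P \<in> homog N"
  using homog_mult[OF homog_const] by simp

lemma homog_power: "P \<in> homog M \<Longrightarrow> P ^ n \<in> homog (n * M)"
proof (induction n)
  case 0
  then show ?case by (simp add: homog_def)
qed (use homog_mult in auto)

lemma homog_gen: "sym_gen i \<in> homog 1"
  by (simp add: homog_def sym_gen_def lookup_single when_def)

lemma homog_sym_basis: "i \<le> N \<Longrightarrow> sym_basis N i \<in> homog N"
  by (simp add: homog_def sym_basis_def sum_2 lookup_basis_exponent)

lemma homog_lin_form: "lin_form g j \<in> homog 1"
  unfolding lin_form_def by (intro homog_sum homog_scale homog_gen)

lemma sym_action_homog:
  assumes "P \<in> homog N"
  shows "sym_action g P \<in> homog N"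
  unfolding sym_action_sym_eval sym_eval_def
proof (intro homog_sum homog_scale)
  fix m assume "m \<in> Poly_Mapping.keys P"
  then have "Poly_Mapping.lookup m 1 * 1 + Poly_Mapping.lookup m 2 * 1 = N"
    using assms by (auto simp: homog_def sum_2)
  then show "(\<Prod>j\<in>UNIV. lin_form g j ^ Poly_Mapping.lookup m j) \<in> homog N"
    using homog_mult[OF homog_power[OF homog_lin_form[of g 1], of "Poly_Mapping.lookup m 1"]
        homog_power[OF homog_lin_form[of g 2], of "Poly_Mapping.lookup m 2"]]
    by (simp add: UNIV_2)
qed

lemma lookup_scale: "Poly_Mapping.lookup (sym_const c * P) m = c * Poly_Mapping.lookup P m"
  unfolding sym_const_def by (simp add: mult_map_scale_conv_mult[symmetric] map.rep_eq when_def)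

lemma lookup_sym_basis: "Poly_Mapping.lookup (sym_basis N i) (basis_exponent N j) = (if i = j then 1 else 0)"
  by (simp add: sym_basis_def lookup_single when_def basis_exponent_inj)

lemma lookup_comb:
  assumes "j \<le> N"
  shows "Poly_Mapping.lookup (\<Sum>i\<le>N. sym_const (c i) * sym_basis N i) (basis_exponent N j) = c j"
  using assms by (simp add: lookup_sum lookup_scale lookup_sym_basis if_distrib[of "\<lambda>a. _ * a"] cong: if_cong)

lemma homog_eqI:
  assumes "P \<in> homog N" "Q \<in> homog N"
    and "\<And>i. i \<le> N \<Longrightarrow> Poly_Mapping.lookup P (basis_exponent N i) = Poly_Mapping.lookup Q (basis_exponent N i)"
  shows "P = Q"
proof (rule poly_mapping_eqI)
  fix m :: "2 \<Rightarrow>\<^sub>0 nat"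
  show "Poly_Mapping.lookup P m = Poly_Mapping.lookup Q m"
  proof (cases "(\<Sum>j\<in>UNIV. Poly_Mapping.lookup m j) = N")
    case True
    show ?thesis
      by (subst (1 2) basis_exponent_lookup(1)[OF True]) (rule assms(3)[OF basis_exponent_lookup(2)[OF True]])
  next
    case False
    then have "m \<notin> Poly_Mapping.keys P" "m \<notin> Poly_Mapping.keys Q"
      using assms by (auto simp: homog_def)
    then show ?thesis by (simp add: in_keys_iff)
  qed
qed

lemma homog_comb: "(\<Sum>i\<le>N. sym_const (c i) * sym_basis N i) \<in> homog N"
  by (intro homog_sum homog_scale homog_sym_basis) auto

lemma homog_expand:
  assumes "P \<in> homog N"
  shows "P = (\<Sum>i\<le>N. sym_const (Poly_Mapping.lookup P (basis_exponent N i)) * sym_basis N i)"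
  using assms by (intro homog_eqI[of _ N] homog_comb) (simp_all add: lookup_comb)

interpretation cpoly: scalar_hom "\<lambda>c. [:c:] :: 'k::field poly"
  by unfold_locales (auto simp: one_pCons)

definition dehom :: "'k::field symalg \<Rightarrow> 'k poly" where
  "dehom = sym_eval (\<lambda>c. [:c:]) (\<lambda>j. if j = 1 then 1 else [:0, 1:])"

lemma dehom_sym_basis: "dehom (sym_basis N i) = monom 1 i"
  unfolding dehom_def sym_basis_def cpoly.sym_eval_single
  by (simp add: UNIV_2 lookup_basis_exponent monom_altdef flip: one_pCons)

text \<open>In a fixed degree the exponent of \<open>e_2\<close> determines that of
  \<open>e_1\<close>, so setting \<open>e_1 = 1\<close> loses nothing.\<close>

lemma coeff_dehom:
  assumes "P \<in> homog N" "i \<le> N"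
  shows "coeff (dehom P) i = Poly_Mapping.lookup P (basis_exponent N i)"
proof -
  have "dehom P = (\<Sum>i\<le>N. [:Poly_Mapping.lookup P (basis_exponent N i):] * monom 1 i)"
    by (subst homog_expand[OF assms(1)])
      (simp add: dehom_def cpoly.sym_eval_sum cpoly.sym_eval_mult cpoly.sym_eval_const dehom_sym_basis[unfolded dehom_def])
  also have "coeff \<dots> i = Poly_Mapping.lookup P (basis_exponent N i)"
    using assms(2) by (simp add: coeff_sum if_distrib[of "\<lambda>a. _ * a"] cong: if_cong)
  finally show ?thesis .
qed

text \<open>Setting \<open>e\<^sub>1 = 1\<close> identifies \<open>S\<^sup>N(V)\<close> with the polynomials of degree at most \<open>N\<close> in \<open>e\<^sub>2\<close>.\<close>

definition rho_poly :: "nat \<Rightarrow> 'k::field ^ 2 ^ 2 \<Rightarrow> nat \<Rightarrow> 'k poly" where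
  "rho_poly N g j = [:g $ 1 $ 1, g $ 2 $ 1:] ^ (N - j) * [:g $ 1 $ 2, g $ 2 $ 2:] ^ j"

definition rho :: "nat \<Rightarrow> 'k::field ^ 2 ^ 2 \<Rightarrow> 'k mat" where
  "rho N g = Matrix.mat (Suc N) (Suc N) (\<lambda>(i, j). coeff (rho_poly N g j) i)"

lemma dehom_sym_action_sym_basis: "dehom (sym_action g (sym_basis N j)) = rho_poly N g j"
proof -
  have "dehom (lin_form g i) = [:g $ 1 $ i, g $ 2 $ i:]" for i
    by (simp add: dehom_def lin_form_def sum_2 cpoly.sym_eval_add cpoly.sym_eval_mult cpoly.sym_eval_const cpoly.sym_eval_gen)
  then show ?thesis
    by (simp add: sym_action_sym_eval sym_basis_def sym.sym_eval_single sym.hom_one UNIV_2 lookup_basis_exponent rho_poly_def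
        dehom_def cpoly.sym_eval_mult cpoly.sym_eval_power)
qed

lemma lookup_sym_action_sym_basis:
  assumes "i \<le> N" "j \<le> N"
  shows "Poly_Mapping.lookup (sym_action g (sym_basis N j)) (basis_exponent N i) = rho N g $$ (i, j)"
  using coeff_dehom[OF sym_action_homog[OF homog_sym_basis[OF assms(2)]] assms(1), of g] assms
  by (simp add: dehom_sym_action_sym_basis rho_def)

section \<open>Endomorphisms of the symmetric power and their matrices\<close>

abbreviation sqmat :: "nat \<Rightarrow> (nat \<times> nat \<Rightarrow> 'a) \<Rightarrow> 'a mat" where
  "sqmat N \<equiv> Matrix.mat (Suc N) (Suc N)"

abbreviation sqmats :: "nat \<Rightarrow> 'a mat set" where
  "sqmats N \<equiv> carrier_mat (Suc N) (Suc N)"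

definition sym_scale :: "'k::field \<Rightarrow> 'k symalg \<Rightarrow> 'k symalg" where
  "sym_scale c P = sym_const c * P"

text \<open>The carrier of \<open>hom_module \<Gamma> (sym_power N)\<close> written without
  \<Gamma>; \<open>endo_scale\<close> and \<open>conj_act\<close> do the same for its scaling and
  its action.\<close>

definition endo :: "nat \<Rightarrow> ('k::field symalg \<Rightarrow> 'k symalg) set" where
  "endo N = {T. linear_map_on sym_scale sym_scale (homog N) T \<and>
     (\<forall>x\<in>homog N. T x \<in> homog N) \<and> (\<forall>x. x \<notin> homog N \<longrightarrow> T x = 0)}"

definition endo_scale :: "'k::field \<Rightarrow> ('k symalg \<Rightarrow> 'k symalg) \<Rightarrow> 'k symalg \<Rightarrow> 'k symalg" where
  "endo_scale c T = (\<lambda>x. sym_scale c (T x))"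

text \<open>The inverse \<open>g'\<close> is a separate argument, so that conjugation is also
  available for matrices outside the group, such as the one that moves its unipotent part into upper
  triangular form.\<close>

definition conj_act :: "nat \<Rightarrow> 'k::field ^ 2 ^ 2 \<Rightarrow> 'k ^ 2 ^ 2 \<Rightarrow> ('k symalg \<Rightarrow> 'k symalg) \<Rightarrow> 'k symalg \<Rightarrow> 'k symalg" where
  "conj_act N g g' T = (\<lambda>x. if x \<in> homog N then sym_action g (T (sym_action g' x)) else 0)"

lemma rep_space_hom_module: "rep_space (hom_module \<Gamma> (sym_power N)) = endo N"
  by (simp add: hom_module_def sym_power_def endo_def homog_def sym_scale_def[abs_def])

lemma rep_scale_hom_module: "rep_scale (hom_module \<Gamma> (sym_power N)) = endo_scale"
  by (simp add: hom_module_def sym_power_def endo_scale_def[abs_def] sym_scale_def)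

lemma rep_act_hom_module:
  "rep_act (hom_module \<Gamma> (sym_power N)) g = conj_act N g (inv\<^bsub>\<Gamma>\<^esub> g)"
  by (simp add: hom_module_def sym_power_def conj_act_def homog_def fun_eq_iff)

definition endo_mat :: "nat \<Rightarrow> ('k::field symalg \<Rightarrow> 'k symalg) \<Rightarrow> 'k mat" where
  "endo_mat N T = sqmat N (\<lambda>(i, j). Poly_Mapping.lookup (T (sym_basis N j)) (basis_exponent N i))"

definition mat_endo :: "nat \<Rightarrow> 'k::field mat \<Rightarrow> 'k symalg \<Rightarrow> 'k symalg" where
  "mat_endo N A P = (if P \<in> homog N then
     \<Sum>i\<le>N. sym_const (\<Sum>j\<le>N. A $$ (i, j) * Poly_Mapping.lookup P (basis_exponent N j)) * sym_basis N i else 0)"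

lemma endo_mat_carrier [simp]: "endo_mat N T \<in> sqmats N"
  by (simp add: endo_mat_def)

lemma rho_carrier [simp]: "rho N g \<in> sqmats N"
  by (simp add: rho_def)

lemma sqmat_mult_index:
  assumes "A \<in> sqmats N" "B \<in> sqmats N" "i \<le> N" "j \<le> N"
  shows "(A * B) $$ (i, j) = (\<Sum>k\<le>N. A $$ (i, k) * B $$ (k, j))"
  using assms
  by (auto simp: scalar_prod_def atLeast0LessThan lessThan_Suc_atMost intro!: sum.cong)

lemma sqmat_eqI:
  assumes "A \<in> sqmats N" "B \<in> sqmats N" "\<And>i j. i \<le> N \<Longrightarrow> j \<le> N \<Longrightarrow> A $$ (i, j) = B $$ (i, j)"
  shows "A = B"
  using assms by (intro eq_matI) (auto simp: less_Suc_eq_le)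

lemma linear_comb:
  assumes lin: "linear_map_on sym_scale sym_scale (homog N) T" and P: "P \<in> homog N"
  shows "T P = (\<Sum>j\<le>N. sym_const (Poly_Mapping.lookup P (basis_exponent N j)) * T (sym_basis N j))"
proof -
  have T0: "T 0 = 0"
    using lin homog_0[of N] unfolding linear_map_on_def sym_scale_def
    by (metis mult_zero_left sym.hom_zero)
  have "T (\<Sum>j\<in>S. sym_const (c j) * sym_basis N j) = (\<Sum>j\<in>S. sym_const (c j) * T (sym_basis N j))"
    if "finite S" "S \<subseteq> {..N}" for S c
    using that
  proof (induction S rule: finite_induct)
    case (insert j S)
    then have "(\<Sum>j\<in>S. sym_const (c j) * sym_basis N j) \<in> homog N" "sym_basis N j \<in> homog N"
      "sym_const (c j) * sym_basis N j \<in> homog N"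
      by (auto intro!: homog_sum homog_scale homog_sym_basis)
    moreover from this lin have "T (sym_const (c j) * sym_basis N j) = sym_const (c j) * T (sym_basis N j)"
      unfolding linear_map_on_def sym_scale_def by blast
    ultimately show ?case using insert lin by (simp add: linear_map_on_def)
  qed (simp add: T0)
  then show ?thesis by (subst homog_expand[OF P]) simp
qed

lemma lookup_linear:
  assumes "linear_map_on sym_scale sym_scale (homog N) T" "P \<in> homog N" "i \<le> N"
  shows "Poly_Mapping.lookup (T P) (basis_exponent N i)
    = (\<Sum>j\<le>N. endo_mat N T $$ (i, j) * Poly_Mapping.lookup P (basis_exponent N j))"
  using assms(3) unfolding linear_comb[OF assms(1,2)]
  by (simp add: lookup_sum lookup_scale endo_mat_def) (simp add: mult.commute)

lemma linear_sym_action: "linear_map_on sym_scale sym_scale S (sym_action g)"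
  by (simp add: linear_map_on_def sym_scale_def sym_action_sym_eval sym.sym_eval_add sym.sym_eval_mult sym.sym_eval_const)

lemma endo_mat_sym_action: "endo_mat N (sym_action g) = rho N g"
  by (rule sqmat_eqI[of _ N]) (simp_all add: endo_mat_def lookup_sym_action_sym_basis)

lemma endo_mat_comp:
  assumes "linear_map_on sym_scale sym_scale (homog N) S" "linear_map_on sym_scale sym_scale (homog N) T"
    and "\<And>x. x \<in> homog N \<Longrightarrow> T x \<in> homog N"
  shows "endo_mat N (\<lambda>x. S (T x)) = endo_mat N S * endo_mat N T"
proof (rule sqmat_eqI)
  fix i j assume ij: "i \<le> N" "j \<le> N"
  have "endo_mat N (\<lambda>x. S (T x)) $$ (i, j) = Poly_Mapping.lookup (S (T (sym_basis N j))) (basis_exponent N i)"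
    using ij by (simp add: endo_mat_def)
  also have "\<dots> = (\<Sum>k\<le>N. endo_mat N S $$ (i, k) * endo_mat N T $$ (k, j))"
    using ij assms(3)[OF homog_sym_basis] by (simp add: lookup_linear[OF assms(1)], simp add: endo_mat_def)
  finally show "endo_mat N (\<lambda>x. S (T x)) $$ (i, j) = (endo_mat N S * endo_mat N T) $$ (i, j)"
    using ij by (simp add: sqmat_mult_index[of _ N])
qed (auto intro: mult_carrier_mat[of _ _ "Suc N"])

lemma rho_mult: "rho N (g ** h) = rho N g * rho N h"
  using endo_mat_comp[OF linear_sym_action linear_sym_action sym_action_homog, of N g h]
  by (simp add: sym_action_mult[symmetric] endo_mat_sym_action)

lemma rho_one: "rho N (id2 :: 'k::field ^ 2 ^ 2) = 1\<^sub>m (Suc N)"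
proof (rule sqmat_eqI)
  fix i j assume ij: "i \<le> N" "j \<le> N"
  have "rho_poly N (id2 :: 'k ^ 2 ^ 2) j = monom 1 j"
    by (simp add: rho_poly_def Finite_Cartesian_Product.mat_def monom_altdef flip: one_pCons)
  then show "rho N (id2 :: 'k ^ 2 ^ 2) $$ (i, j) = 1\<^sub>m (Suc N) $$ (i, j)"
    using ij by (auto simp: rho_def)
qed auto

lemma endo_linear: "T \<in> endo N \<Longrightarrow> linear_map_on sym_scale sym_scale (homog N) T"
  and endo_homog: "T \<in> endo N \<Longrightarrow> x \<in> homog N \<Longrightarrow> T x \<in> homog N"
  and endo_outside: "T \<in> endo N \<Longrightarrow> x \<notin> homog N \<Longrightarrow> T x = 0"
  by (auto simp: endo_def)

lemma linear_comp:
  assumes "linear_map_on sym_scale sym_scale (homog N) S" "linear_map_on sym_scale sym_scale (homog N) T"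
    and "\<And>x. x \<in> homog N \<Longrightarrow> T x \<in> homog N"
  shows "linear_map_on sym_scale sym_scale (homog N) (\<lambda>x. S (T x))"
  using assms by (simp add: linear_map_on_def)

lemma endo_mat_cong: "(\<And>x. x \<in> homog N \<Longrightarrow> S x = T x) \<Longrightarrow> endo_mat N S = endo_mat N T"
  by (rule sqmat_eqI[of _ N]) (auto simp: endo_mat_def homog_sym_basis)

lemma endo_mat_conj_act:
  assumes T: "T \<in> endo N"
  shows "endo_mat N (conj_act N g g' T) = rho N g * endo_mat N T * rho N g'"
proof -
  have "endo_mat N (conj_act N g g' T) = endo_mat N (\<lambda>x. sym_action g (T (sym_action g' x)))"
    by (rule endo_mat_cong) (simp add: conj_act_def)
  also have "\<dots> = rho N g * endo_mat N (\<lambda>x. T (sym_action g' x))"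
    using T endo_mat_comp[OF linear_sym_action linear_comp[OF endo_linear[OF T] linear_sym_action]]
    by (simp add: sym_action_homog endo_homog endo_mat_sym_action)
  also have "endo_mat N (\<lambda>x. T (sym_action g' x)) = endo_mat N T * rho N g'"
    using T endo_mat_comp[OF endo_linear[OF T] linear_sym_action]
    by (simp add: sym_action_homog endo_mat_sym_action)
  finally show ?thesis by (simp add: assoc_mult_mat[of _ "Suc N" "Suc N" _ "Suc N" _ "Suc N"])
qed

lemma conj_act_endo:
  assumes T: "T \<in> endo N"
  shows "conj_act N g g' T \<in> endo N"
proof -
  have "linear_map_on sym_scale sym_scale (homog N) (\<lambda>x. sym_action g (T (sym_action g' x)))"
    using linear_comp[OF linear_sym_action linear_comp[OF endo_linear[OF T] linear_sym_action]] T
    by (simp add: sym_action_homog endo_homog)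
  then show ?thesis
    using T by (auto simp: endo_def conj_act_def linear_map_on_def homog_add homog_scale
        sym_scale_def sym_action_homog)
qed

lemma endo_eqI:
  assumes "S \<in> endo N" "T \<in> endo N" "endo_mat N S = endo_mat N T"
  shows "S = T"
proof
  fix x
  show "S x = T x"
  proof (cases "x \<in> homog N")
    case True
    then show ?thesis
      using assms lookup_linear[OF endo_linear, of _ N x] by (intro homog_eqI[of _ N]) (auto simp: endo_homog)
  qed (use assms in \<open>simp add: endo_outside\<close>)
qed

lemma mat_endo_endo: "mat_endo N A \<in> endo N"
proof -
  have "linear_map_on sym_scale sym_scale (homog N) (mat_endo N A)"
    unfolding linear_map_on_def
  proof (intro conjI ballI allI)
    fix x y :: "'a symalg" assume xy: "x \<in> homog N" "y \<in> homog N"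
    then show "mat_endo N A (x + y) = mat_endo N A x + mat_endo N A y"
      by (simp add: mat_endo_def homog_add lookup_add algebra_simps sum.distrib sym.hom_add)
  next
    fix c :: 'a and x :: "'a symalg" assume x: "x \<in> homog N"
    have "(\<Sum>j\<le>N. A $$ (i, j) * (c * Poly_Mapping.lookup x (basis_exponent N j)))
        = c * (\<Sum>j\<le>N. A $$ (i, j) * Poly_Mapping.lookup x (basis_exponent N j))" for i
      by (simp add: sum_distrib_left mult_ac)
    then show "mat_endo N A (sym_scale c x) = sym_scale c (mat_endo N A x)"
      using x by (simp add: mat_endo_def homog_scale lookup_scale sym_scale_def sym.hom_mult
          sum_distrib_left[of "sym_const c"] mult.assoc)
  qed
  then show ?thesis by (auto simp: endo_def homog_comb) (auto simp: mat_endo_def homog_comb)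
qed

lemma endo_mat_mat_endo:
  assumes "A \<in> sqmats N"
  shows "endo_mat N (mat_endo N A) = A"
  using assms
  by (intro sqmat_eqI[of _ N])
    (simp_all add: endo_mat_def mat_endo_def homog_sym_basis lookup_comb lookup_sym_basis if_distrib[of "\<lambda>a. _ * a"] cong: if_cong)

lemma mat_endo_endo_mat: "T \<in> endo N \<Longrightarrow> mat_endo N (endo_mat N T) = T"
  by (intro endo_eqI[of _ N]) (simp_all add: mat_endo_endo endo_mat_mat_endo)

lemma endo_0: "0 \<in> endo N"
  by (simp add: endo_def linear_map_on_def homog_0 sym_scale_def)

lemma endo_add: "S \<in> endo N \<Longrightarrow> T \<in> endo N \<Longrightarrow> S + T \<in> endo N"
  by (auto simp: endo_def linear_map_on_def homog_add sym_scale_def algebra_simps)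

lemma endo_scale_endo: "T \<in> endo N \<Longrightarrow> endo_scale c T \<in> endo N"
  by (auto simp: endo_def linear_map_on_def homog_scale endo_scale_def sym_scale_def algebra_simps)

lemma sum_endo_scale_mat_endo:
  "(\<Sum>l\<in>J. endo_scale (a l) (mat_endo N (A l)))
    = mat_endo N (sqmat N (\<lambda>ij. \<Sum>l\<in>J. a l * A l $$ ij))"
proof
  fix x
  have apply_sum: "(\<Sum>l\<in>J. F l) x = (\<Sum>l\<in>J. F l x)" for F :: "'b \<Rightarrow> 'a symalg \<Rightarrow> 'a symalg"
    by (induction J rule: infinite_finite_induct) auto
  show "(\<Sum>l\<in>J. endo_scale (a l) (mat_endo N (A l))) x
      = mat_endo N (sqmat N (\<lambda>ij. \<Sum>l\<in>J. a l * A l $$ ij)) x"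
  proof (cases "x \<in> homog N")
    case True
    have "(\<Sum>l\<in>J. endo_scale (a l) (mat_endo N (A l))) x \<in> homog N"
      using True mat_endo_endo[of N, THEN endo_homog]
      by (auto simp: apply_sum endo_scale_def sym_scale_def intro!: homog_sum homog_scale)
    moreover have "Poly_Mapping.lookup ((\<Sum>l\<in>J. endo_scale (a l) (mat_endo N (A l))) x) (basis_exponent N i)
        = Poly_Mapping.lookup (mat_endo N (sqmat N (\<lambda>ij. \<Sum>l\<in>J. a l * A l $$ ij)) x) (basis_exponent N i)"
      if "i \<le> N" for i
      using that True
      by (simp add: apply_sum endo_scale_def sym_scale_def lookup_sum lookup_scale mat_endo_def lookup_comb
          sum_distrib_left sum_distrib_right mult.assoc sum.swap[of _ J])
    ultimately show ?thesis
      using True mat_endo_endo[of N, THEN endo_homog] by (intro homog_eqI[of _ N]) auto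
  qed (simp add: apply_sum endo_scale_def sym_scale_def mat_endo_def)
qed

text \<open>All later degree counts rest on this restriction of a polynomial function to the span of
  finitely many matrices.\<close>

lemma mpoly_fun_mat_endo:
  assumes "polyfun_le endo_scale (endo N) d f" "finite J"
  shows "mpoly_fun J d (\<lambda>a. f (mat_endo N (sqmat N (\<lambda>ij. \<Sum>l\<in>J. a l * A l $$ ij))))"
proof -
  have "mpoly_fun J d (\<lambda>a. f (\<Sum>l\<in>J. endo_scale (a l) (mat_endo N (A l))))"
    using assms
    by (rule polyfun_le_mpoly_fun) (auto simp: endo_0 endo_add endo_scale_endo mat_endo_endo,
      simp add: endo_scale_def sym_scale_def fun_eq_iff)
  then show ?thesis by (simp only: sum_endo_scale_mat_endo)
qed

subsection \<open>Degree bound at the identity\<close>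

definition mat2 :: "'k \<Rightarrow> 'k \<Rightarrow> 'k \<Rightarrow> 'k \<Rightarrow> 'k ^ 2 ^ 2" where
  "mat2 a b c d = (\<chi> i j. if i = 1 then if j = 1 then a else b else if j = 1 then c else d)"

lemma mat2_nth [simp]: "mat2 a b c d $ 1 $ 1 = a" "mat2 a b c d $ 1 $ 2 = b"
  "mat2 a b c d $ 2 $ 1 = c" "mat2 a b c d $ 2 $ 2 = d"
  by (simp_all add: mat2_def)

lemma mat2_eq_iff: "A = B \<longleftrightarrow> A $ 1 $ 1 = B $ 1 $ 1 \<and> A $ 1 $ 2 = B $ 1 $ 2 \<and>
    A $ 2 $ 1 = B $ 2 $ 1 \<and> A $ 2 $ 2 = B $ 2 $ 2" for A B :: "'k ^ 2 ^ 2"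
  by (auto simp: Finite_Cartesian_Product.vec_eq_iff forall_2)

lemma mat2_mult: "mat2 a b c d ** mat2 a' b' c' d'
    = mat2 (a * a' + b * c') (a * b' + b * d') (c * a' + d * c') (c * b' + d * d')"
  for a :: "'k::comm_ring_1"
  by (simp add: mat2_eq_iff matrix_matrix_mult_def sum_2)

lemma mat2_one: "mat2 1 0 0 1 = id2"
  by (simp add: mat2_eq_iff Finite_Cartesian_Product.mat_def)

definition upper :: "'k::comm_ring_1 \<Rightarrow> 'k ^ 2 ^ 2" where
  "upper t = mat2 1 t 0 1"

lemma upper_add: "upper s ** upper t = upper (s + t)"
  by (simp add: upper_def mat2_mult add.commute)

lemma upper_zero: "upper 0 = id2"
  by (simp add: upper_def mat2_one)

text \<open>After setting \<open>e_1 = 1\<close>, \<open>upper t\<close> acts as the substitution of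
  \<open>e_2 + t\<close> for \<open>e_2\<close>, and the entries come from the binomial
  theorem.\<close>

lemma rho_upper:
  assumes "i \<le> N" "j \<le> N"
  shows "rho N (upper t) $$ (i, j) = of_nat (j choose i) * t ^ (j - i)"
proof -
  have "rho_poly N (upper t) j = [:t, 1:] ^ j"
    by (simp add: rho_poly_def upper_def flip: one_pCons)
  moreover have "coeff ([:t, 1:] ^ j) i = of_nat (j choose i) * t ^ (j - i)"
  proof (cases "i \<le> j")
    case False
    then show ?thesis by (simp add: coeff_eq_0 degree_linear_power binomial_eq_0)
  qed (simp add: coeff_linear_poly_power)
  ultimately show ?thesis using assms by (simp add: rho_def)
qed

lemma conj_act_mat_endo:
  assumes "A \<in> sqmats N"
  shows "conj_act N g g' (mat_endo N A) = mat_endo N (rho N g * A * rho N g')"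
proof (rule endo_eqI[of _ N])
  have "rho N g * A * rho N g' \<in> sqmats N"
    using assms by (intro mult_carrier_mat[of _ _ "Suc N"]) auto
  then show "endo_mat N (conj_act N g g' (mat_endo N A)) = endo_mat N (mat_endo N (rho N g * A * rho N g'))"
    using assms by (simp add: endo_mat_conj_act mat_endo_endo endo_mat_mat_endo)
qed (simp_all add: mat_endo_endo conj_act_endo)

lemma sqmat_sum_mult:
  fixes c :: "'b \<Rightarrow> 'k::field"
  assumes "B \<in> sqmats N" "C \<in> sqmats N" "\<And>l. l \<in> J \<Longrightarrow> A l \<in> sqmats N"
  shows "B * sqmat N (\<lambda>ij. \<Sum>l\<in>J. c l * A l $$ ij) * C
    = sqmat N (\<lambda>ij. \<Sum>l\<in>J. c l * (B * A l * C) $$ ij)" (is "?L = ?R")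
proof (rule sqmat_eqI[of _ N])
  have BA: "B * X \<in> sqmats N" if "X \<in> sqmats N" for X
    using that assms by (auto intro: mult_carrier_mat[of _ _ "Suc N"])
  show "?L \<in> sqmats N" "?R \<in> sqmats N"
    using BA assms by (auto intro: mult_carrier_mat[of _ _ "Suc N"])
  fix i j assume ij: "i \<le> N" "j \<le> N"
  have "?L $$ (i, j) = (\<Sum>k\<le>N. (\<Sum>m\<le>N. B $$ (i, m) * (\<Sum>l\<in>J. c l * A l $$ (m, k))) * C $$ (k, j))"
    using ij BA assms by (simp add: sqmat_mult_index[of _ N] del: index_mult_mat(1))
  also have "\<dots> = (\<Sum>k\<le>N. \<Sum>l\<in>J. \<Sum>m\<le>N. c l * (B $$ (i, m) * A l $$ (m, k) * C $$ (k, j)))"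
    by (intro sum.cong refl, subst sum.swap) (simp add: sum_distrib_left sum_distrib_right mult_ac)
  also have "\<dots> = (\<Sum>l\<in>J. \<Sum>k\<le>N. \<Sum>m\<le>N. c l * (B $$ (i, m) * A l $$ (m, k) * C $$ (k, j)))"
    by (rule sum.swap)
  also have "\<dots> = (\<Sum>l\<in>J. c l * (B * A l * C) $$ (i, j))"
    using ij BA assms
    by (intro sum.cong refl) (simp add: sqmat_mult_index[of _ N] sum_distrib_left sum_distrib_right mult_ac
        del: index_mult_mat(1))
  finally show "?L $$ (i, j) = ?R $$ (i, j)" using ij by simp
qed

text \<open>The projection onto \<open>e\<^sub>2 ^ N\<close> along the other vectors \<open>u\<^sub>a (e\<^sub>2 ^ N)\<close>, \<open>a ^ Suc N = a\<close>: its coordinate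
  functional takes the value \<open>1 - a ^ N\<close> on \<open>u\<^sub>a (e\<^sub>2 ^ N)\<close>.\<close>

definition pure_tensor :: "nat \<Rightarrow> 'k::field mat" where
  "pure_tensor N = sqmat N (\<lambda>(i, j). if i = N then of_bool (j = N) - of_bool (j = 0) else 0)"

definition upper_conj :: "nat \<Rightarrow> 'k::field \<Rightarrow> 'k mat" where
  "upper_conj N a = rho N (upper a) * pure_tensor N * rho N (upper (- a))"

lemma pure_tensor_carrier [simp]: "pure_tensor N \<in> sqmats N"
  by (simp add: pure_tensor_def)

lemma upper_conj_carrier [simp]: "upper_conj N a \<in> sqmats N"
  unfolding upper_conj_def by (intro mult_carrier_mat[of _ _ "Suc N"]) auto

text \<open>Only row \<open>N\<close> of \<open>pure_tensor N\<close> can be nonzero, so the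
  conjugate is the outer product of column \<open>N\<close> of \<open>rho N (upper a)\<close> with
  one transformed row.\<close>

lemma upper_conj_index:
  assumes ij: "i \<le> N" "j \<le> N"
  shows "upper_conj N a $$ (i, j)
    = of_nat (N choose i) * a ^ (N - i) * (of_bool (j = N) - (- a) ^ j)"
proof -
  have c: "pure_tensor N * rho N (upper (- a)) \<in> sqmats N"
    by (intro mult_carrier_mat[of _ _ "Suc N"]) auto
  have row: "(pure_tensor N * rho N (upper (- a))) $$ (k, j)
      = (if k = N then of_bool (j = N) - (- a) ^ j else 0)" if "k \<le> N" for k
  proof -
    have "(pure_tensor N * rho N (upper (- a))) $$ (k, j)
        = (\<Sum>l\<le>N. (if k = N then of_bool (l = N) - of_bool (l = 0) else 0) * (of_nat (j choose l) * (- a) ^ (j - l)))"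
      using that ij by (simp add: sqmat_mult_index[of _ N] rho_upper del: index_mult_mat(1)) (simp add: pure_tensor_def)
    also have "\<dots> = (if k = N then of_nat (j choose N) * (- a) ^ (j - N) - (- a) ^ j else 0)"
      by (simp add: left_diff_distrib sum_subtractf of_bool_def if_distrib[of "\<lambda>b. b * _"] cong: if_cong)
    also have "of_nat (j choose N) * (- a) ^ (j - N) = of_bool (j = N)"
      using ij by (cases "j = N") (auto simp: binomial_eq_0)
    finally show ?thesis .
  qed
  have "upper_conj N a = rho N (upper a) * (pure_tensor N * rho N (upper (- a)))"
    unfolding upper_conj_def by (rule assoc_mult_mat[of _ "Suc N" "Suc N" _ "Suc N" _ "Suc N"]) auto
  then have "upper_conj N a $$ (i, j) = (\<Sum>k\<le>N. rho N (upper a) $$ (i, k) *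
      (if k = N then of_bool (j = N) - (- a) ^ j else 0))"
    using ij row by (simp add: sqmat_mult_index[OF _ c] del: index_mult_mat(1))
  also have "\<dots> = rho N (upper a) $$ (i, N) * (of_bool (j = N) - (- a) ^ j)"
    by (simp add: if_distrib[of "\<lambda>b. _ * b"] cong: if_cong)
  finally show ?thesis using ij by (simp add: rho_upper)
qed

text \<open>The summands are the projections of a decomposition into lines permuted by the additive
  group of the subfield, hence add up to the identity. The proof checks entries through the power
  sums with exponents \<open>N - i\<close> and \<open>N - i + j\<close>.\<close>

lemma sum_upper_conj:
  assumes char: "prime CHAR('k::alg_closed_field)" and n: "n > 0" and N: "Suc N = CHAR('k) ^ n"
  shows "sqmat N (\<lambda>ij. \<Sum>a\<in>(frob_fixed (Suc N) :: 'k set). 1 * upper_conj N a $$ ij) = 1\<^sub>m (Suc N)"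
proof (rule sqmat_eqI[of _ N])
  fix i j assume ij: "i \<le> N" "j \<le> N"
  let ?E = "frob_fixed (Suc N) :: 'k set"
  have N_pos: "N > 0"
    using one_less_power[OF prime_gt_1_nat[OF char] n] by (simp flip: N)
  have S: "(\<Sum>a\<in>?E. a ^ m) = (if m = N \<or> m = 2 * N then - 1 else 0)" if "m \<le> 2 * N" for m
    using power_sum_frob_fixed[OF char n, of m] that by (simp flip: N)
  have binom: "of_nat (N choose l) = (- 1 :: 'k) ^ l" if "l \<le> N" for l
    using of_nat_pred_prime_power_choose[OF char, of l n] that by (simp flip: N)
  have "(\<Sum>a\<in>?E. upper_conj N a $$ (i, j))
      = (\<Sum>a\<in>?E. of_bool (j = N) * of_nat (N choose i) * a ^ (N - i)
          - of_nat (N choose i) * (- 1) ^ j * a ^ (N - i + j))"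
    unfolding upper_conj_index[OF ij]
    by (intro sum.cong refl, subst power_minus) (simp add: power_add algebra_simps)
  also have "\<dots> = of_bool (j = N) * of_nat (N choose i) * (\<Sum>a\<in>?E. a ^ (N - i))
          - of_nat (N choose i) * (- 1) ^ j * (\<Sum>a\<in>?E. a ^ (N - i + j))"
    by (simp add: sum_subtractf sum_distrib_left)
  also have "(\<Sum>a\<in>?E. a ^ (N - i)) = (if i = 0 then - 1 else 0)"
    using ij N_pos by (subst S) auto
  also have "(\<Sum>a\<in>?E. a ^ (N - i + j)) = (if i = j \<or> i = 0 \<and> j = N then - 1 else 0)"
    using ij N_pos by (subst S) auto
  \<comment> \<open>At the corner \<open>(0, N)\<close> both power sums contribute and cancel, as
    \<open>(- 1) ^ N\<close> equals \<open>of_nat (N choose N) = 1\<close> in the field. On the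
    diagonal, \<open>N choose i\<close> equals \<open>(- 1) ^ i\<close> and the two signs
    cancel.\<close>
  also have "of_bool (j = N) * of_nat (N choose i) * (if i = 0 then - 1 else 0)
          - of_nat (N choose i) * (- 1) ^ j * (if i = j \<or> i = 0 \<and> j = N then - 1 else 0)
          = (if i = j then 1 else 0 :: 'k)"
    using ij N_pos binom[of i] binom[of N]
    by (auto simp: simp flip: power_mult_distrib)
  finally show "sqmat N (\<lambda>ij. \<Sum>a\<in>?E. 1 * upper_conj N a $$ ij) $$ (i, j) = 1\<^sub>m (Suc N) $$ (i, j)"
    using ij by simp
qed auto

lemma upper_conj_shift:
  "rho N (upper (- t)) * upper_conj N a * rho N (upper t) = upper_conj N (a - t)"
proof -
  let ?r = "\<lambda>t. rho N (upper t)"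
  note assoc = assoc_mult_mat[of _ "Suc N" "Suc N" _ "Suc N" _ "Suc N"]
  note [simp] = mult_carrier_mat[of _ "Suc N" "Suc N" _ "Suc N"]
  have "?r (- t) * upper_conj N a * ?r t = ?r (- t) * (?r a * pure_tensor N) * (?r (- a) * ?r t)"
    unfolding upper_conj_def by (simp add: assoc)
  also have "?r (- t) * (?r a * pure_tensor N) = ?r (- t) * ?r a * pure_tensor N"
    by (simp add: assoc)
  finally have "?r (- t) * upper_conj N a * ?r t = (?r (- t) * ?r a) * pure_tensor N * (?r (- a) * ?r t)" .
  then show ?thesis by (simp add: upper_conj_def upper_add flip: rho_mult)
qed

text \<open>On the span of the matrices \<open>upper_conj N a\<close>, conjugation by
  \<open>upper t\<close> with \<open>t\<close> in the subfield translates the coefficients, so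
  \<open>translation_invariant_mpoly_fun_at_1\<close> applies in degrees below \<open>Suc N\<close>.
  All coefficients \<open>1\<close> give the identity, all \<open>0\<close> the zero map.\<close>

lemma upper_invariant_at_one:
  fixes f :: "('k::alg_closed_field symalg \<Rightarrow> 'k symalg) \<Rightarrow> 'k"
  assumes char: "prime CHAR('k)" and n: "n > 0" and N: "Suc N = CHAR('k) ^ n"
    and inf: "infinite (UNIV :: 'k set)"
    and f: "polyfun_le endo_scale (endo N) d f" "d \<le> N"
    and inv: "\<And>t T. T \<in> endo N \<Longrightarrow> f (conj_act N (upper t) (upper (- t)) T) = f T"
  shows "f (mat_endo N (1\<^sub>m (Suc N))) = f 0"
proof -
  let ?E = "frob_fixed (Suc N) :: 'k set"
  let ?M = "\<lambda>c :: 'k \<Rightarrow> 'k. sqmat N (\<lambda>ij. \<Sum>a\<in>?E. c a * upper_conj N a $$ ij)"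
  note [simp] = mult_carrier_mat[of _ "Suc N" "Suc N" _ "Suc N"]
  have E: "finite ?E" "card ?E = Suc N"
    using finite_frob_fixed[OF char n] card_frob_fixed[OF char n] by (simp_all add: N)
  have sub: "0 \<in> ?E" "\<And>a b. a \<in> ?E \<Longrightarrow> b \<in> ?E \<Longrightarrow> a + b \<in> ?E" "\<And>a. a \<in> ?E \<Longrightarrow> - a \<in> ?E"
    using frob_fixed_subgroup[OF char, where n = n] by (simp_all add: N)
  have "f (mat_endo N (?M (\<lambda>_. 1))) = f (mat_endo N (?M (\<lambda>_. 0)))"
  proof (rule translation_invariant_mpoly_fun_at_1[OF inf refl _ E(1) sub(1,2,3)])
    show "CHAR('k) > 0" using char prime_gt_0_nat by blast
    show "mpoly_fun ?E d (\<lambda>c. f (mat_endo N (?M c)))" by (rule mpoly_fun_mat_endo[OF f(1) E(1)])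
    show "d < card ?E" using f(2) E(2) by simp
    fix c :: "'k \<Rightarrow> 'k" and t :: 'k assume t: "t \<in> ?E"
    have "bij_betw (\<lambda>a. a + t) ?E ?E"
      using t sub by (intro bij_betwI[where g = "\<lambda>a. a - t"])
        (auto simp: diff_conv_add_uminus simp del: add_uminus_conv_diff)
    then have "(\<Sum>a\<in>?E. c (a + t) * upper_conj N a $$ ij) = (\<Sum>a\<in>?E. c a * upper_conj N (a - t) $$ ij)" for ij
      using sum.reindex_bij_betw[of "\<lambda>a. a + t" ?E ?E "\<lambda>a. c a * upper_conj N (a - t) $$ ij"] by simp
    then have "?M (\<lambda>a. c (a + t)) = rho N (upper (- t)) * ?M c * rho N (upper t)"
      by (simp add: sqmat_sum_mult upper_conj_shift)
    then have "mat_endo N (?M (\<lambda>a. c (a + t))) = conj_act N (upper (- t)) (upper t) (mat_endo N (?M c))"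
      by (simp add: conj_act_mat_endo)
    then show "f (mat_endo N (?M (\<lambda>a. c (a + t)))) = f (mat_endo N (?M c))"
      using inv[OF mat_endo_endo, of "- t"] by simp
  qed
  moreover have "?M (\<lambda>_. 1) = 1\<^sub>m (Suc N)" by (rule sum_upper_conj[OF char n N])
  moreover have "mat_endo N (?M (\<lambda>_. 0)) = 0"
    by (rule endo_eqI[of _ N]) (auto simp: mat_endo_endo endo_0 endo_mat_mat_endo, auto simp: endo_mat_def intro: sqmat_eqI)
  ultimately show ?thesis by simp
qed

subsection \<open>Invariants at fixed points of the unipotent group\<close>

text \<open>The degree bound is explicit because the interpolation in
  \<open>upper_invariant_eq_scalar\<close> needs one bound valid for every value of the other
  parameter.\<close>

definition upoly_fun :: "nat \<Rightarrow> ('k::idom \<Rightarrow> 'k) \<Rightarrow> bool" where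
  "upoly_fun D \<phi> \<longleftrightarrow> (\<exists>P. degree P \<le> D \<and> (\<forall>t. \<phi> t = poly P t))"

lemma upoly_fun_const: "upoly_fun D (\<lambda>_. c)"
  unfolding upoly_fun_def by (intro exI[of _ "[:c:]"]) auto

lemma upoly_fun_id: "1 \<le> D \<Longrightarrow> upoly_fun D (\<lambda>t. t)"
  unfolding upoly_fun_def by (intro exI[of _ "[:0, 1:]"]) auto

lemma upoly_fun_mono: "upoly_fun D \<phi> \<Longrightarrow> D \<le> E \<Longrightarrow> upoly_fun E \<phi>"
  unfolding upoly_fun_def using order_trans by blast

lemma upoly_fun_add:
  assumes "upoly_fun D \<phi>" "upoly_fun D \<psi>"
  shows "upoly_fun D (\<lambda>t. \<phi> t + \<psi> t)"
proof -
  obtain P Q where "degree P \<le> D" "\<And>t. \<phi> t = poly P t" "degree Q \<le> D" "\<And>t. \<psi> t = poly Q t"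
    using assms by (auto simp: upoly_fun_def)
  then show ?thesis
    unfolding upoly_fun_def by (intro exI[of _ "P + Q"]) (auto intro: degree_add_le)
qed

lemma upoly_fun_mult:
  assumes "upoly_fun D \<phi>" "upoly_fun E \<psi>"
  shows "upoly_fun (D + E) (\<lambda>t. \<phi> t * \<psi> t)"
proof -
  obtain P Q where "degree P \<le> D" "\<And>t. \<phi> t = poly P t" "degree Q \<le> E" "\<And>t. \<psi> t = poly Q t"
    using assms by (auto simp: upoly_fun_def)
  then show ?thesis
    unfolding upoly_fun_def
    by (intro exI[of _ "P * Q"]) (auto intro: order_trans[OF degree_mult_le])
qed

lemma upoly_fun_sum:
  assumes "\<And>i. i \<in> I \<Longrightarrow> upoly_fun D (\<phi> i)"
  shows "upoly_fun D (\<lambda>t. \<Sum>i\<in>I. \<phi> i t)"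
  using assms
  by (induction I rule: infinite_finite_induct) (auto intro: upoly_fun_const upoly_fun_add)

lemma upoly_fun_power:
  assumes "upoly_fun D \<phi>"
  shows "upoly_fun (n * D) (\<lambda>t. \<phi> t ^ n)"
  by (induction n) (use assms in \<open>auto intro: upoly_fun_const upoly_fun_mult\<close>)

lemma upoly_fun_prod_power:
  assumes "finite J" "\<And>j. j \<in> J \<Longrightarrow> upoly_fun D (\<phi> j)"
  shows "upoly_fun (sum k J * D) (\<lambda>t. \<Prod>j\<in>J. \<phi> j t ^ k j)"
  using assms
proof (induction J rule: finite_induct)
  case (insert j J)
  then show ?case
    using upoly_fun_mult[OF upoly_fun_power[of D "\<phi> j" "k j"], of "sum k J * D"]
    by (simp add: add_mult_distrib)
qed (auto intro: upoly_fun_const)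

lemma mpoly_fun_upoly_fun:
  assumes "finite J" "mpoly_fun J d \<Phi>" "\<And>j. j \<in> J \<Longrightarrow> upoly_fun D (\<lambda>t. a t j)"
  shows "upoly_fun (d * D) (\<lambda>t. \<Phi> (a t))"
proof -
  obtain c where c: "\<And>x. \<Phi> x = (\<Sum>k\<in>exponents J d. c k * monomial_val J k x)"
    using assms(2) by (auto simp: mpoly_fun_def)
  have "upoly_fun (d * D) (\<lambda>t. c k * monomial_val J k (a t))" if k: "k \<in> exponents J d" for k
  proof -
    have "sum k J * D \<le> d * D" using k by (simp add: exponents_def)
    then have "upoly_fun (d * D) (\<lambda>t. monomial_val J k (a t))"
      unfolding monomial_val_def
      using upoly_fun_prod_power[OF assms(1), of D "\<lambda>j t. a t j" k] assms(3) upoly_fun_mono by blast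
    then show ?thesis using upoly_fun_mult[OF upoly_fun_const[of 0]] by fastforce
  qed
  then show ?thesis unfolding c by (rule upoly_fun_sum)
qed

lemma upoly_fun_coeff_mult:
  assumes "\<And>i. upoly_fun D (\<lambda>t. coeff (P t) i)" "\<And>i. upoly_fun E (\<lambda>t. coeff (Q t) i)"
  shows "upoly_fun (D + E) (\<lambda>t. coeff (P t * Q t) i)"
  unfolding coeff_mult using assms by (intro upoly_fun_sum upoly_fun_mult)

lemma upoly_fun_coeff_power:
  assumes "\<And>i. upoly_fun D (\<lambda>t. coeff (P t) i)"
  shows "upoly_fun (n * D) (\<lambda>t. coeff (P t ^ n) i)"
proof (induction n arbitrary: i)
  case (Suc n)
  then show ?case using upoly_fun_coeff_mult[OF assms Suc] by simp
qed (auto intro: upoly_fun_const)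

text \<open>An entry in column \<open>j\<close> has degree \<open>N - j\<close> in the first column
  of the group element and degree \<open>j\<close> in the second.\<close>

lemma upoly_fun_rho:
  assumes g: "\<And>i j. upoly_fun 1 (\<lambda>t. g t $ i $ j)" and ij: "i \<le> N" "j \<le> N"
  shows "upoly_fun N (\<lambda>t. rho N (g t) $$ (i, j))"
proof -
  have lin: "upoly_fun 1 (\<lambda>t. coeff [:g t $ 1 $ l, g t $ 2 $ l:] k)" for l k
  proof -
    consider "k = 0" | "k = 1" | m where "k = Suc (Suc m)" by (metis One_nat_def not0_implies_Suc)
    then show ?thesis using g by cases (simp_all add: upoly_fun_const)
  qed
  have "upoly_fun ((N - j) * 1 + j * 1) (\<lambda>t. coeff (rho_poly N (g t) j) i)"
    unfolding rho_poly_def by (intro upoly_fun_coeff_mult upoly_fun_coeff_power lin)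
  then show ?thesis using ij by (simp add: rho_def)
qed

lemma upoly_fun_sqmat_mult:
  assumes "\<And>t. A t \<in> sqmats N" "\<And>t. B t \<in> sqmats N"
    and "\<And>i j. i \<le> N \<Longrightarrow> j \<le> N \<Longrightarrow> upoly_fun D (\<lambda>t. A t $$ (i, j))"
    and "\<And>i j. i \<le> N \<Longrightarrow> j \<le> N \<Longrightarrow> upoly_fun E (\<lambda>t. B t $$ (i, j))"
    and "i \<le> N" "j \<le> N"
  shows "upoly_fun (D + E) (\<lambda>t. (A t * B t) $$ (i, j))"
  unfolding sqmat_mult_index[OF assms(1,2,5,6)]
  using assms by (intro upoly_fun_sum upoly_fun_mult) auto

lemma upoly_fun_mat_endo:
  assumes f: "polyfun_le endo_scale (endo N) d f"
    and B: "\<And>t. B t \<in> sqmats N" "\<And>i j. i \<le> N \<Longrightarrow> j \<le> N \<Longrightarrow> upoly_fun D (\<lambda>t. B t $$ (i, j))"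
  shows "upoly_fun (d * D) (\<lambda>t. f (mat_endo N (B t)))"
proof -
  let ?J = "{..N} \<times> {..N}"
  \<comment> \<open>The spanning matrices are the matrix units, so the coefficients are the entries
    of \<open>B t\<close>.\<close>
  let ?M = "\<lambda>a. sqmat N (\<lambda>ij. \<Sum>l\<in>?J. a l * sqmat N (\<lambda>kl. of_bool (kl = l)) $$ ij)"
  have "?M (\<lambda>ij. B t $$ ij) = B t" for t
    using B(1)[of t]
    by (intro sqmat_eqI[of _ N]) (auto simp: of_bool_def if_distrib[of "\<lambda>b. _ * b"] sum.delta cong: if_cong)
  moreover have "mpoly_fun ?J d (\<lambda>a. f (mat_endo N (?M a)))"
    by (rule mpoly_fun_mat_endo[OF f]) simp
  then have "upoly_fun (d * D) (\<lambda>t. f (mat_endo N (?M (\<lambda>ij. B t $$ ij))))"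
    by (rule mpoly_fun_upoly_fun[where \<Phi> = "\<lambda>a. f (mat_endo N (?M a))", rotated]) (use B in auto)
  ultimately show ?thesis by simp
qed

text \<open>Lagrange interpolation: the weight at \<open>x\<close> is the value at \<open>0\<close>
  of the basis polynomial \<open>B x\<close>. The weights serve all polynomials of degree at most
  \<open>D\<close> at once.\<close>

lemma interpolation_at_0:
  fixes X :: "'k::field set"
  assumes X: "finite X" "card X = Suc D"
  obtains L where "\<And>P. degree P \<le> D \<Longrightarrow> poly P 0 = (\<Sum>x\<in>X. L x * poly P x)"
proof
  define B where "B x = (\<Prod>y\<in>X - {x}. Polynomial.smult (1 / (x - y)) [:- y, 1:])" for x
  fix P :: "'k poly" assume P: "degree P \<le> D"
  have Bx: "poly (B x) y = of_bool (x = y)" if "x \<in> X" "y \<in> X" for x y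
    using that X by (cases "x = y") (auto simp: B_def poly_prod simp flip: diff_divide_distrib intro!: prod.neutral)
  have degB: "degree (B x) \<le> D" if "x \<in> X" for x
  proof -
    have "degree (B x) \<le> (\<Sum>y\<in>X - {x}. degree (Polynomial.smult (1 / (x - y)) [:- y, 1:]))"
      unfolding B_def
      using degree_prod_sum_le[of "X - {x}" "\<lambda>y. Polynomial.smult (1 / (x - y)) [:- y, 1:]"] X
      by (simp add: o_def)
    also have "\<dots> \<le> (\<Sum>y\<in>X - {x}. 1)" by (intro sum_mono) (auto intro: order_trans[OF degree_smult_le])
    also have "\<dots> = D" using X that by simp
    finally show ?thesis .
  qed
  define Q where "Q = (\<Sum>x\<in>X. Polynomial.smult (poly P x) (B x))"
  have "P = Q"
  proof (rule poly_eqI_degree[of X])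
    show "poly P y = poly Q y" if "y \<in> X" for y
      using that X by (simp add: Q_def poly_sum Bx of_bool_def if_distrib[of "\<lambda>b. _ * b"] cong: if_cong)
    show "degree P < card X" using P X by simp
    have "degree Q \<le> D"
      unfolding Q_def using X degB
      by (intro degree_sum_le) (auto intro: order_trans[OF degree_smult_le])
    then show "degree Q < card X" using X by simp
  qed
  then have "poly P 0 = poly Q 0" by simp
  also have "\<dots> = (\<Sum>x\<in>X. poly (B x) 0 * poly P x)"
    by (simp add: Q_def poly_sum mult.commute)
  finally show "poly P 0 = (\<Sum>x\<in>X. poly (B x) 0 * poly P x)" .
qed

text \<open>Comparing the coefficients of \<open>t ^ m\<close> in the entry \<open>(i, N)\<close> of
  the two products expresses \<open>A $$ (i, N - m)\<close> through the last column, since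
  \<open>N choose m\<close> is a sign in the field. Left of the diagonal the index
  \<open>i + m\<close> runs past \<open>N\<close>; on the diagonal it equals
  \<open>N\<close>.\<close>

lemma upper_commutant:
  fixes A :: "'k::field mat"
  assumes inf: "infinite (UNIV :: 'k set)"
    and char: "prime CHAR('k)" and N: "Suc N = CHAR('k) ^ n"
    and A: "A \<in> sqmats N" and comm: "\<And>t. rho N (upper t) * A = A * rho N (upper t)"
    and ij: "i \<le> N" "j \<le> N"
  shows "j < i \<Longrightarrow> A $$ (i, j) = 0" and "A $$ (i, i) = A $$ (N, N)"
proof -
  have key: "(if i + m \<le> N then A $$ (i + m, N) * of_nat ((i + m) choose i) else 0)
      = A $$ (i, N - m) * of_nat (N choose m)" if m: "m \<le> N" for m
  proof -
    \<comment> \<open>For \<open>k < i\<close> the truncated exponent \<open>k - i\<close> does no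
      harm, the binomial coefficient being zero.\<close>
    define P where "P = (\<Sum>k\<le>N. monom (A $$ (k, N) * of_nat (k choose i)) (k - i))"
    define Q where "Q = (\<Sum>k\<le>N. monom (A $$ (i, k) * of_nat (N choose k)) (N - k))"
    have "poly (P - Q) t = 0" for t
    proof -
      have "poly P t = (rho N (upper t) * A) $$ (i, N)"
        using ij A by (simp add: sqmat_mult_index[of _ N] rho_upper P_def poly_sum poly_monom mult_ac
            del: index_mult_mat(1))
      moreover have "poly Q t = (A * rho N (upper t)) $$ (i, N)"
        using ij A by (simp add: sqmat_mult_index[of _ N] rho_upper Q_def poly_sum poly_monom mult_ac
            del: index_mult_mat(1))
      ultimately show ?thesis using comm[of t] by simp
    qed
    then have "P - Q = 0" using inf by (intro poly_eq_0_if_infinite_zeros[of UNIV])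
    then have "coeff P m = coeff Q m" by simp
    moreover have "coeff P m = (\<Sum>k\<le>N. if k = i + m then A $$ (k, N) * of_nat (k choose i) else 0)"
      unfolding P_def coeff_sum
      by (intro sum.cong refl) (auto simp: not_le binomial_eq_0)
    moreover have "coeff Q m = (\<Sum>k\<le>N. if k = N - m then A $$ (i, k) * of_nat (N choose k) else 0)"
      unfolding Q_def coeff_sum using m by (intro sum.cong refl) auto
    ultimately show ?thesis using m by (simp add: binomial_symmetric[of m N])
  qed
  have ne: "of_nat (N choose m) \<noteq> (0 :: 'k)" if "m \<le> N" for m
    using of_nat_pred_prime_power_choose[OF char, of m n] that by (simp flip: N)
  show "A $$ (i, j) = 0" if "j < i"
  proof -
    have "\<not> i + (N - j) \<le> N" using ij that by linarith
    then show ?thesis using key[of "N - j"] ne[of "N - j"] ij by simp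
  qed
  show "A $$ (i, i) = A $$ (N, N)"
    using key[of "N - i"] ne[of "N - i"] ij by (simp add: binomial_symmetric[of i N])
qed

text \<open>For upper triangular \<open>A\<close> and nonzero \<open>t\<close> this is the conjugate
  of \<open>A\<close> by the image of \<open>diag(t, 1/t)\<close>. The exponents are nonnegative, so
  the path extends to \<open>t = 0\<close>, where \<open>0 ^ 0 = 1\<close> keeps exactly the
  diagonal.\<close>

definition torus_path :: "nat \<Rightarrow> 'k::field mat \<Rightarrow> 'k \<Rightarrow> 'k mat" where
  "torus_path N A t = sqmat N (\<lambda>(i, j). if i \<le> j then t ^ (2 * (j - i)) * A $$ (i, j) else 0)"

lemma torus_path_carrier [simp]: "torus_path N A t \<in> sqmats N"
  by (simp add: torus_path_def)

lemma rho_diag: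
  assumes "i \<le> N" "j \<le> N"
  shows "rho N (mat2 a 0 0 d) $$ (i, j) = (if i = j then a ^ (N - j) * d ^ j else 0)"
proof -
  have "rho_poly N (mat2 a 0 0 d) j = [:a ^ (N - j):] * monom (d ^ j) j"
  proof -
    have "[:0, d:] = monom d 1" by (simp add: monom_altdef)
    then show ?thesis by (simp add: rho_poly_def monom_power poly_const_pow)
  qed
  then show ?thesis using assms by (simp add: rho_def)
qed

lemma torus_path_conj:
  fixes A :: "'k::field mat"
  assumes t: "t \<noteq> 0" and A: "A \<in> sqmats N"
    and tri: "\<And>i j. i \<le> N \<Longrightarrow> j < i \<Longrightarrow> A $$ (i, j) = 0"
  shows "rho N (mat2 (1 / t) 0 0 t) * torus_path N A t * rho N (mat2 t 0 0 (1 / t)) = A"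
proof (rule sqmat_eqI[of _ N])
  note [simp] = mult_carrier_mat[of _ "Suc N" "Suc N" _ "Suc N"]
  show "rho N (mat2 (1 / t) 0 0 t) * torus_path N A t * rho N (mat2 t 0 0 (1 / t)) \<in> sqmats N"
    by simp
  fix i j assume ij: "i \<le> N" "j \<le> N"
  have "(rho N (mat2 (1 / t) 0 0 t) * torus_path N A t * rho N (mat2 t 0 0 (1 / t))) $$ (i, j)
      = (1 / t) ^ (N - i) * t ^ i * torus_path N A t $$ (i, j) * (t ^ (N - j) * (1 / t) ^ j)"
    using ij by (simp add: sqmat_mult_index[of _ N] rho_diag if_distrib[of "\<lambda>b. b * _"]
        if_distrib[of "\<lambda>b. _ * b"] del: index_mult_mat(1) cong: if_cong)
  also have "\<dots> = A $$ (i, j)"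
  proof (cases "i \<le> j")
    case True
    have "t ^ i * t ^ (2 * (j - i)) * t ^ (N - j) = t ^ (N - i) * t ^ j"
      unfolding power_add[symmetric] using ij True by (intro arg_cong[where f = "power t"]) simp
    then show ?thesis
      using True ij t by (simp add: torus_path_def power_one_over divide_simps) (simp add: mult_ac)
  next
    case False
    then show ?thesis using ij tri by (simp add: torus_path_def)
  qed
  finally show "(rho N (mat2 (1 / t) 0 0 t) * torus_path N A t * rho N (mat2 t 0 0 (1 / t))) $$ (i, j)
      = A $$ (i, j)" .
qed (rule A)

text \<open>For a fixed point \<open>w\<close> of the unipotent group \<open>U\<close>, the function
  \<open>(t, s) \<mapsto> f (g\<^sup>-\<^sup>1 w\<^sub>t)\<close>, with \<open>g \<in> SL\<^sub>2\<close> of first column \<open>(t, s)\<close> and \<open>w\<^sub>t\<close> the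
  degeneration of \<open>w\<close> under the torus, does not depend on the choice of \<open>g\<close> because \<open>f\<close> is
  \<open>U\<close>-invariant. It is polynomial in \<open>t\<close> for \<open>s \<noteq> 0\<close> and in \<open>s\<close> for \<open>t \<noteq> 0\<close>, with
  value \<open>f w\<^sub>0\<close> on \<open>t = 0\<close> and \<open>f w\<close> on \<open>s = 0\<close>; interpolating in \<open>t\<close> away from \<open>0\<close> and then
  letting \<open>s\<close> tend to \<open>0\<close> equates the two.\<close>

lemma upper_invariant_eq_scalar:
  fixes f :: "('k::field symalg \<Rightarrow> 'k symalg) \<Rightarrow> 'k"
  assumes inf: "infinite (UNIV :: 'k set)"
    and char: "prime CHAR('k)" and N: "Suc N = CHAR('k) ^ n"
    and f: "polyfun_le endo_scale (endo N) d f"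
    and inv: "\<And>t T. T \<in> endo N \<Longrightarrow> f (conj_act N (upper t) (upper (- t)) T) = f T"
    and A: "A \<in> sqmats N" and comm: "\<And>t. rho N (upper t) * A = A * rho N (upper t)"
  shows "f (mat_endo N A) = f (mat_endo N (A $$ (N, N) \<cdot>\<^sub>m 1\<^sub>m (Suc N)))"
proof -
  note [simp] = mult_carrier_mat[of _ "Suc N" "Suc N" _ "Suc N"]
  note assoc = assoc_mult_mat[of _ "Suc N" "Suc N" _ "Suc N" _ "Suc N"]
  let ?c = "A $$ (N, N)" and ?w = "torus_path N A"
  have tri: "A $$ (i, j) = 0" if "i \<le> N" "j < i" for i j
    using upper_commutant(1)[OF inf char N A comm, of i j] that by simp
  have diag: "A $$ (i, i) = ?c" if "i \<le> N" for i
    using upper_commutant(2)[OF inf char N A comm that that] .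
  define F where "F B = f (mat_endo N B)" for B
  have Finv: "F (rho N (upper c) * B * rho N (upper (- c))) = F B" if "B \<in> sqmats N" for c B
    using inv[OF mat_endo_endo, of c B] that by (simp add: F_def conj_act_mat_endo)
  \<comment> \<open>Two completions of the first column \<open>(t, s)\<close> to determinant one:
    \<psi> uses the second column \<open>(- 1 / s, 0)\<close>, and \<xi> on the next line uses
    \<open>(0, 1 / t)\<close>.\<close>
  define \<psi> where "\<psi> s t = F (rho N (mat2 0 (1 / s) (- s) t) * ?w t * rho N (mat2 t (- 1 / s) s 0))" for s t
  define \<xi> where "\<xi> t s = F (rho N (mat2 (1 / t) 0 (- s) t) * ?w t * rho N (mat2 t 0 s (1 / t)))" for s t
  have mat2_upoly: "upoly_fun 1 (\<lambda>t. mat2 (a t) (b t) (c t) (e t) $ i $ j)"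
    if "upoly_fun 1 a" "upoly_fun 1 b" "upoly_fun 1 c" "upoly_fun 1 e" for a b c e :: "'k \<Rightarrow> 'k" and i j
    using that exhaust_2[of i] exhaust_2[of j] by auto
  have w_upoly: "upoly_fun (2 * N) (\<lambda>t. ?w t $$ (i, j))" if ij: "i \<le> N" "j \<le> N" for i j
  proof -
    have "upoly_fun (2 * (j - i) * 1 + 0) (\<lambda>t. t ^ (2 * (j - i)) * A $$ (i, j))"
      by (intro upoly_fun_mult upoly_fun_power upoly_fun_id upoly_fun_const) simp
    then have "upoly_fun (2 * N) (\<lambda>t. t ^ (2 * (j - i)) * A $$ (i, j))"
      by (rule upoly_fun_mono) (use ij in simp)
    then show ?thesis using ij by (cases "i \<le> j") (simp_all add: torus_path_def upoly_fun_const)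
  qed
  \<comment> \<open>The two \<open>rho\<close> factors have degree at most \<open>N\<close> and the
    torus path at most \<open>2 * N\<close>; \<open>f\<close> multiplies the sum by
    \<open>d\<close>.\<close>
  let ?D = "d * (N + 2 * N + N)"
  have \<psi>_upoly: "upoly_fun ?D (\<psi> s)" for s
    unfolding \<psi>_def F_def
    by (intro upoly_fun_mat_endo[OF f] upoly_fun_sqmat_mult upoly_fun_rho mat2_upoly w_upoly
        upoly_fun_const upoly_fun_id) simp_all
  have \<xi>_upoly: "upoly_fun ?D (\<xi> t)" for t
  proof -
    have "upoly_fun 1 (\<lambda>s :: 'k. - s)"
      unfolding upoly_fun_def by (intro exI[of _ "[:0, - 1:]"]) auto
    then show ?thesis
      unfolding \<xi>_def F_def
      by (intro upoly_fun_mat_endo[OF f] upoly_fun_sqmat_mult upoly_fun_rho mat2_upoly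
        upoly_fun_const upoly_fun_id) simp_all
  qed
  \<comment> \<open>The two completions differ by right multiplication with
    \<open>upper (- c)\<close>, where \<open>c = 1 / (s * t)\<close>, and \<open>f\<close> does not
    see this factor.\<close>
  have \<psi>\<xi>: "\<psi> s t = \<xi> t s" if "s \<noteq> 0" "t \<noteq> 0" for s t
  proof -
    define c where "c = 1 / (s * t)"
    have 1: "mat2 0 (1 / s) (- s) t = upper c ** mat2 (1 / t) 0 (- s) t"
      using that by (simp add: upper_def mat2_mult c_def)
    have 2: "mat2 t (- 1 / s) s 0 = mat2 t 0 s (1 / t) ** upper (- c)"
      using that by (simp add: upper_def mat2_mult c_def)
    let ?g = "rho N (mat2 t 0 s (1 / t))" and ?g' = "rho N (mat2 (1 / t) 0 (- s) t)"
    have "rho N (upper c) * ?g' * ?w t * (?g * rho N (upper (- c)))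
        = rho N (upper c) * (?g' * ?w t * ?g) * rho N (upper (- c))"
      by (simp add: assoc)
    then show ?thesis
      unfolding \<psi>_def \<xi>_def 1 2 rho_mult using Finv[of "?g' * ?w t * ?g" c] by simp
  qed
  have w0: "?w 0 = ?c \<cdot>\<^sub>m 1\<^sub>m (Suc N)"
  proof (rule sqmat_eqI[of _ N])
    fix i j assume "i \<le> N" "j \<le> N"
    then show "?w 0 $$ (i, j) = (?c \<cdot>\<^sub>m 1\<^sub>m (Suc N)) $$ (i, j)"
      using diag[of i] by (cases "i = j") (auto simp: torus_path_def power_0_left)
  qed auto
  have \<psi>0: "\<psi> s 0 = F (?c \<cdot>\<^sub>m 1\<^sub>m (Suc N))" if "s \<noteq> 0" for s
  proof -
    let ?h' = "rho N (mat2 0 (1 / s) (- s) 0)" and ?h = "rho N (mat2 0 (- 1 / s) s 0)"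
    have "?h' * (?c \<cdot>\<^sub>m 1\<^sub>m (Suc N)) * ?h = ?c \<cdot>\<^sub>m (?h' * ?h)"
      by (simp add: mult_smult_distrib[of _ "Suc N" "Suc N" _ "Suc N"]
          mult_smult_assoc_mat[of _ "Suc N" "Suc N" _ "Suc N"] right_mult_one_mat[of _ "Suc N"])
    also have "?h' * ?h = 1\<^sub>m (Suc N)"
      using that by (simp add: mat2_mult mat2_one rho_one flip: rho_mult)
    finally show ?thesis unfolding \<psi>_def w0 by simp
  qed
  have \<xi>0: "\<xi> t 0 = F A" if "t \<noteq> 0" for t
    unfolding \<xi>_def using torus_path_conj[OF that A] tri by simp
  \<comment> \<open>The nodes avoid \<open>0\<close>, so at each node \<psi> may be replaced by
    \<xi>, which makes sense at \<open>s = 0\<close> as well.\<close>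
  have "infinite (UNIV - {0 :: 'k})" using inf by simp
  then obtain X where X: "X \<subseteq> UNIV - {0 :: 'k}" "finite X" "card X = Suc ?D"
    using infinite_arbitrarily_large by blast
  have X0: "x \<noteq> 0" if "x \<in> X" for x using X(1) that by blast
  obtain L where L: "\<And>P. degree P \<le> ?D \<Longrightarrow> poly P 0 = (\<Sum>x\<in>X. L x * poly P x)"
    using interpolation_at_0[OF X(2,3)] by blast
  have L1: "(\<Sum>x\<in>X. L x) = 1" using L[of 1] by simp
  have eq: "(\<Sum>x\<in>X. L x * \<xi> x s) = F (?c \<cdot>\<^sub>m 1\<^sub>m (Suc N))" if s: "s \<noteq> 0" for s
  proof -
    obtain P where P: "degree P \<le> ?D" "\<And>t. \<psi> s t = poly P t"
      using \<psi>_upoly[of s] by (auto simp: upoly_fun_def)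
    have "(\<Sum>x\<in>X. L x * \<xi> x s) = (\<Sum>x\<in>X. L x * \<psi> s x)"
      using s by (intro sum.cong refl) (simp add: \<psi>\<xi> X0)
    also have "\<dots> = \<psi> s 0" using L[OF P(1)] by (simp add: P(2))
    finally show ?thesis using \<psi>0[OF s] by simp
  qed
  have "upoly_fun ?D (\<lambda>s. \<Sum>x\<in>X. L x * \<xi> x s)"
    using upoly_fun_mult[OF upoly_fun_const[of 0] \<xi>_upoly] by (intro upoly_fun_sum) simp
  then obtain Q where Q: "\<And>s. (\<Sum>x\<in>X. L x * \<xi> x s) = poly Q s"
    by (auto simp: upoly_fun_def)
  \<comment> \<open>The weighted sum is constant for nonzero \<open>s\<close> and polynomial in
    \<open>s\<close>, so it has the same value at \<open>s = 0\<close>.\<close>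
  have "Q - [:F (?c \<cdot>\<^sub>m 1\<^sub>m (Suc N)):] = 0"
    using \<open>infinite (UNIV - {0})\<close> by (rule poly_eq_0_if_infinite_zeros) (simp add: eq flip: Q)
  then have "poly Q 0 = F (?c \<cdot>\<^sub>m 1\<^sub>m (Suc N))" by simp
  moreover have "poly Q 0 = (\<Sum>x\<in>X. L x * F A)"
    unfolding Q[symmetric] by (intro sum.cong refl) (simp add: \<xi>0 X0)
  ultimately show ?thesis using L1 by (simp add: F_def flip: sum_distrib_right)
qed

subsection \<open>Unipotent subgroups and the invariant bound\<close>

lemma group_GL2: "group (GL2 :: ('k::field ^ 2 ^ 2) monoid)"
proof (rule groupI)
  fix A :: "'k ^ 2 ^ 2" assume "A \<in> carrier GL2"
  then obtain B where "A ** B = id2" "B ** A = id2"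
    by (auto simp: GL2_def invertible_def)
  then show "\<exists>B\<in>carrier GL2. B \<otimes>\<^bsub>GL2\<^esub> A = \<one>\<^bsub>GL2\<^esub>"
    by (intro bexI[of _ B]) (auto simp: GL2_def invertible_def)
next
  have "invertible (id2 :: 'k ^ 2 ^ 2)"
    unfolding invertible_def by (intro exI[of _ "id2"]) simp
  then show "\<one>\<^bsub>GL2\<^esub> \<in> carrier (GL2 :: ('k ^ 2 ^ 2) monoid)" by (simp add: GL2_def)
qed (simp_all add: GL2_def invertible_mult matrix_mul_assoc)

text \<open>The nilpotent \<open>X = h - 1\<close> has determinant zero, so Cayley-Hamilton reads
  \<open>X ^ 2 = \<tau> X\<close> with \<tau> the trace. The powers of \<open>X\<close> are then
  \<open>\<tau> ^ k X\<close>, and nilpotency forces \<tau> to be zero.\<close>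

lemma unipotent_trace_det:
  fixes h :: "'k::field ^ 2 ^ 2"
  assumes "unipotent h"
  shows "h $ 1 $ 1 + h $ 2 $ 2 = 2" "h $ 1 $ 1 * h $ 2 $ 2 - h $ 1 $ 2 * h $ 2 $ 1 = 1"
proof -
  define X where "X = h - id2"
  define \<tau> where "\<tau> = X $ 1 $ 1 + X $ 2 $ 2"
  have h: "h $ 1 $ 1 = X $ 1 $ 1 + 1" "h $ 2 $ 2 = X $ 2 $ 2 + 1" "h $ 1 $ 2 = X $ 1 $ 2" "h $ 2 $ 1 = X $ 2 $ 1"
    by (simp_all add: X_def Finite_Cartesian_Product.mat_def)
  obtain m where m: "(((**) X) ^^ m) id2 = 0"
    using assms by (auto simp: unipotent_def X_def)
  have "Determinants.det ((((**) X) ^^ k) id2) = Determinants.det X ^ k" for k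
    by (induction k) (simp_all add: det_mul)
  from this[of m] have "Determinants.det X ^ m = 0" using m by (simp add: det_2)
  then have "Determinants.det X = 0" by simp
  then have d: "X $ 1 $ 1 * X $ 2 $ 2 = X $ 1 $ 2 * X $ 2 $ 1" by (simp add: det_2)
  have sq: "X ** (\<chi> i j. c * X $ i $ j) = (\<chi> i j. (\<tau> * c) * X $ i $ j)" for c
    unfolding mat2_eq_iff using d by (simp add: matrix_matrix_mult_def sum_2 \<tau>_def algebra_simps)
  have pow: "(((**) X) ^^ Suc k) id2 = (\<chi> i j. \<tau> ^ k * X $ i $ j)" for k
    by (induction k) (simp_all add: sq)
  have "\<tau> = 0"
  proof (rule ccontr)
    assume "\<tau> \<noteq> 0"
    have "m \<noteq> 0" using m by (intro notI) (simp add: mat2_eq_iff Finite_Cartesian_Product.mat_def)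
    then obtain k where "m = Suc k" by (cases m) auto
    then have 0: "(\<chi> i j. \<tau> ^ k * X $ i $ j) = 0" using m pow by simp
    have "\<tau> ^ k * X $ i $ j = 0" for i j
      using arg_cong[OF 0, of "\<lambda>M. M $ i $ j"] by simp
    then have "X $ i $ j = 0" for i j using \<open>\<tau> \<noteq> 0\<close> by simp
    then show False using \<open>\<tau> \<noteq> 0\<close> by (simp add: \<tau>_def)
  qed
  then show "h $ 1 $ 1 + h $ 2 $ 2 = 2" "h $ 1 $ 1 * h $ 2 $ 2 - h $ 1 $ 2 * h $ 2 $ 1 = 1"
    using d by (simp_all add: h \<tau>_def algebra_simps)
qed

text \<open>Conjugate one nontrivial element \<open>k\<close> of \<open>H\<close> to
  \<open>upper 1\<close>. For \<open>x\<close> in \<open>H\<close>, both \<open>x\<close> and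
  \<open>x ** k\<close> have trace \<open>2\<close>; their conjugates differ in trace by the lower
  left entry of the conjugate of \<open>x\<close>, which therefore vanishes. Trace and determinant
  then fix the diagonal.\<close>

lemma unipotent_subgroup_conj_upper:
  fixes H :: "('k::field ^ 2 ^ 2) set"
  assumes H: "subgroup H GL2" "infinite H" "\<And>h. h \<in> H \<Longrightarrow> unipotent h"
  obtains g g' :: "'k ^ 2 ^ 2" where "g ** g' = id2" "g' ** g = id2"
    "infinite {t. g ** upper t ** g' \<in> H}"
proof -
  have "\<not> H \<subseteq> {id2}" using H(2) finite_subset by blast
  then obtain k where k: "k \<in> H" "k \<noteq> id2" by blast
  define a b c where "a = k $ 1 $ 1 - 1" and "b = k $ 1 $ 2" and "c = k $ 2 $ 1"
  note tr = unipotent_trace_det(1)[OF H(3)] and dt = unipotent_trace_det(2)[OF H(3)]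
  have k22: "k $ 2 $ 2 = 1 - a" using tr[OF k(1)] by (simp add: a_def algebra_simps)
  have k11: "k $ 1 $ 1 = 1 + a" by (simp add: a_def)
  have abc: "a * a + b * c = 0"
    using dt[OF k(1)] unfolding k11 k22 b_def[symmetric] c_def[symmetric]
    by (simp add: algebra_simps)
  have k_eq: "k = mat2 (1 + a) b c (1 - a)"
    using k11 k22 by (simp add: mat2_eq_iff b_def c_def)
  have bc: "b \<noteq> 0 \<or> c \<noteq> 0"
  proof (rule ccontr)
    assume "\<not> ?thesis"
    then have "a = 0" "b = 0" "c = 0" using abc by auto
    then show False using k(2) k_eq by (simp add: mat2_one)
  qed
  \<comment> \<open>The columns of \<open>g\<close> are \<open>(k - 1) v\<close> and
    \<open>v\<close> for a basis vector \<open>v\<close> that \<open>k\<close> moves: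
    \<open>v = e_2\<close> if \<open>b\<close> is nonzero, and \<open>v = e_1\<close>
    otherwise.\<close>
  obtain g g' where g: "g ** g' = id2" "g' ** g = id2"
    and kg: "g' ** k ** g = upper 1"
  proof (cases "b = 0")
    case False
    show ?thesis
    proof (rule that[of "mat2 b 0 (- a) 1" "mat2 (1 / b) 0 (a / b) 1"])
      have c: "c = - a * a / b" using abc False by (simp add: field_simps add_eq_0_iff)
      show "mat2 (1 / b) 0 (a / b) 1 ** k ** mat2 b 0 (- a) 1 = upper 1"
        using False unfolding k_eq c by (simp add: mat2_mult upper_def field_simps)
    qed (use False in \<open>simp_all add: mat2_mult flip: mat2_one\<close>)
  next
    case True
    then have "a = 0" "c \<noteq> 0" using abc bc by auto
    show ?thesis
    proof (rule that[of "mat2 0 1 c 0" "mat2 0 (1 / c) 1 0"])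
      show "mat2 0 (1 / c) 1 0 ** k ** mat2 0 1 c 0 = upper 1"
        using \<open>c \<noteq> 0\<close> unfolding k_eq \<open>a = 0\<close> \<open>b = 0\<close> by (simp add: mat2_mult upper_def)
    qed (use \<open>c \<noteq> 0\<close> in \<open>simp_all add: mat2_mult flip: mat2_one\<close>)
  qed
  have conj_tr: "(g' ** x ** g) $ 1 $ 1 + (g' ** x ** g) $ 2 $ 2 = x $ 1 $ 1 + x $ 2 $ 2" for x
  proof -
    have "(g' ** x ** g) $ 1 $ 1 + (g' ** x ** g) $ 2 $ 2 = trace (g' ** x ** g)"
      by (simp add: trace_def sum_2)
    also have "\<dots> = trace (g ** (g' ** x))" by (rule trace_mul_sym)
    also have "\<dots> = trace x" by (simp add: matrix_mul_assoc g)
    finally show ?thesis by (simp add: trace_def sum_2)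
  qed
  have conj_det: "Determinants.det (g' ** x ** g) = Determinants.det x" for x
  proof -
    have "Determinants.det g' * Determinants.det g = 1" using arg_cong[OF g(2), of Determinants.det] by (simp add: det_mul)
    then show ?thesis by (simp add: det_mul mult.assoc mult.commute[of _ "Determinants.det g"])
  qed
  have upp: "\<exists>t. x = g ** upper t ** g'" if x: "x \<in> H" for x
  proof -
    define y where "y = g' ** x ** g"
    have xk: "x ** k \<in> H" using subgroup.m_closed[OF H(1) x k(1)] by (simp add: GL2_def)
    have "g' ** (x ** k) ** g = y ** upper 1"
      unfolding y_def kg[symmetric] by (metis g(1) matrix_mul_assoc matrix_mul_rid)
    then have "(y ** upper 1) $ 1 $ 1 + (y ** upper 1) $ 2 $ 2 = 2"
      using conj_tr[of "x ** k"] tr[OF xk] by simp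
    moreover have ytr: "y $ 1 $ 1 + y $ 2 $ 2 = 2"
      using conj_tr[of x] tr[OF x] by (simp add: y_def)
    moreover have "(y ** upper 1) $ 1 $ 1 + (y ** upper 1) $ 2 $ 2 = y $ 2 $ 1 + (y $ 1 $ 1 + y $ 2 $ 2)"
      by (simp add: matrix_matrix_mult_def sum_2 upper_def)
    ultimately have y21: "y $ 2 $ 1 = 0" by simp
    have "y $ 1 $ 1 * y $ 2 $ 2 = 1"
      using conj_det[of x] dt[OF x] y21 by (simp add: y_def det_2)
    moreover have "y $ 2 $ 2 = 2 - y $ 1 $ 1" using ytr by (metis add_diff_cancel_left')
    ultimately have "(y $ 1 $ 1 - 1) * (y $ 1 $ 1 - 1) = 0" by (simp add: algebra_simps)
    then have y11: "y $ 1 $ 1 = 1" by simp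
    then have "y $ 2 $ 2 = 1" using \<open>y $ 2 $ 2 = 2 - y $ 1 $ 1\<close> by simp
    then have "y = upper (y $ 1 $ 2)" using y11 y21 by (simp add: mat2_eq_iff upper_def)
    moreover have "x = g ** y ** g'"
      unfolding y_def by (metis g(1) matrix_mul_assoc matrix_mul_lid matrix_mul_rid)
    ultimately show ?thesis by metis
  qed
  have "H \<subseteq> (\<lambda>t. g ** upper t ** g') ` {t. g ** upper t ** g' \<in> H}" using upp by blast
  then have "infinite {t. g ** upper t ** g' \<in> H}" using H(2) finite_surj by blast
  then show ?thesis using that g by blast
qed

text \<open>Along the line of all \<open>g ** upper t ** g'\<close> each defining equation of
  \<open>G\<close> is a polynomial in \<open>t\<close> with infinitely many zeros.\<close>

lemma closed_in_GL2_line: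
  fixes G :: "('k::field ^ 2 ^ 2) set"
  assumes G: "closed_in_GL2 G" and g: "g ** g' = id2" "g' ** g = id2"
    and inf: "infinite {t. g ** upper t ** g' \<in> G}"
  shows "g ** upper t ** g' \<in> G"
proof -
  let ?s = "\<lambda>(c :: 'k) (A :: 'k ^ 2 ^ 2). (\<chi> i j. c * A $ i $ j) :: 'k ^ 2 ^ 2"
  obtain I where I: "I \<subseteq> polyfuns ?s UNIV" "G = {A \<in> carrier GL2. \<forall>f\<in>I. f A = 0}"
    using G by (auto simp: closed_in_GL2_def)
  have "f (g ** upper t ** g') = 0" if f: "f \<in> I" for f
  proof -
    obtain d where d: "polyfun_le ?s UNIV d f" using I(1) f by (auto simp: polyfuns_def)
    \<comment> \<open>The affine line is placed in the span of two matrices: the direction with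
      coefficient \<open>t\<close> and the base point \<open>g ** g'\<close> with coefficient
      \<open>1\<close>.\<close>
    define E where "E b = (if b then g ** mat2 0 1 0 0 ** g' else g ** g')" for b
    define a where "a t b = (if b then t else 1)" for t :: 'k and b
    have line: "(\<Sum>b\<in>UNIV. ?s (a t b) (E b)) = g ** upper t ** g'" for t
      by (simp add: UNIV_bool E_def a_def mat2_eq_iff matrix_matrix_mult_def sum_2 upper_def algebra_simps)
    have "mpoly_fun UNIV d (\<lambda>a. f (\<Sum>b\<in>UNIV. ?s (a b) (E b)))"
      by (rule polyfun_le_mpoly_fun[OF d]) (auto simp: Finite_Cartesian_Product.vec_eq_iff)
    then have "upoly_fun (d * 1) (\<lambda>t. f (\<Sum>b\<in>UNIV. ?s (a t b) (E b)))"
    proof (rule mpoly_fun_upoly_fun[rotated])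
      show "upoly_fun 1 (\<lambda>t. a t b)" for b
        by (cases b) (simp_all add: a_def upoly_fun_const upoly_fun_id)
    qed simp
    then obtain P where P: "\<And>t. f (g ** upper t ** g') = poly P t"
      unfolding line by (auto simp: upoly_fun_def)
    have "P = 0"
      using inf by (rule poly_eq_0_if_infinite_zeros) (use f I(2) in \<open>auto simp flip: P\<close>)
    then show ?thesis using P by simp
  qed
  moreover have "invertible (g ** upper t ** g')"
    unfolding invertible_def
  proof (intro exI conjI)
    have "g ** upper t ** g' ** (g ** upper (- t) ** g') = g ** (upper t ** ((g' ** g) ** upper (- t))) ** g'"
      by (simp only: matrix_mul_assoc)
    then show "g ** upper t ** g' ** (g ** upper (- t) ** g') = id2"
      by (simp add: g upper_add upper_zero)
    have "g ** upper (- t) ** g' ** (g ** upper t ** g') = g ** (upper (- t) ** ((g' ** g) ** upper t)) ** g'"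
      by (simp only: matrix_mul_assoc)
    then show "g ** upper (- t) ** g' ** (g ** upper t ** g') = id2"
      by (simp add: g upper_add upper_zero)
  qed
  ultimately show ?thesis using I(2) by (auto simp: GL2_def)
qed

section \<open>Polynomial functions under linear maps, and the determinant as an invariant\<close>

lemma polyfun_le_sum:
  assumes "finite I" "\<And>i. i \<in> I \<Longrightarrow> polyfun_le s W d (f i)"
  shows "polyfun_le s W d (\<lambda>w. \<Sum>i\<in>I. f i w)"
  using assms by (induction I rule: finite_induct) (auto intro: polyfun_le.const polyfun_le.add)

lemma polyfun_le_prod:
  assumes "finite I" "\<And>i. i \<in> I \<Longrightarrow> polyfun_le s W 1 (f i)"
  shows "polyfun_le s W (card I) (\<lambda>w. \<Prod>i\<in>I. f i w)"
  using assms
proof (induction I rule: finite_induct)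
  case (insert i I)
  then show ?case using polyfun_le.mult[of s W 1 "f i" "card I"] by simp
qed (simp add: polyfun_le.const)

lemma polyfun_le_comp:
  assumes "polyfun_le s W d f"
    and "\<And>x. x \<in> V \<Longrightarrow> L x \<in> W" and "linear_map_on r s V L"
  shows "polyfun_le r V d (\<lambda>x. f (L x))"
  using assms(1)
proof (induction rule: polyfun_le.induct)
  case (linear f)
  then show ?case using assms(2,3) by (intro polyfun_le.linear) (simp add: linear_map_on_def)
qed (auto intro: polyfun_le.intros)

lemma conj_act_linear: "linear_map_on endo_scale endo_scale (endo N) (conj_act N g g')"
  by (auto simp: linear_map_on_def endo_scale_def sym_scale_def conj_act_def fun_eq_iff
      sym_action_sym_eval sym.sym_eval_add sym.sym_eval_mult sym.sym_eval_const)

lemma conj_act_conj_act: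
  "conj_act N g g' (conj_act N k k' T) = conj_act N (g ** k) (k' ** g') T"
  by (auto simp: conj_act_def fun_eq_iff sym_action_mult sym_action_homog)

lemma conj_act_0: "conj_act N g g' 0 = 0"
  by (auto simp: conj_act_def fun_eq_iff sym_action_sym_eval sym.sym_eval_0)

lemma mat_endo_zero: "mat_endo N (0 \<cdot>\<^sub>m 1\<^sub>m (Suc N)) = 0"
  by (auto simp: mat_endo_def fun_eq_iff sym.hom_zero)

lemma conj_act_mat_endo_one:
  assumes "g ** g' = id2"
  shows "conj_act N g g' (mat_endo N (1\<^sub>m (Suc N))) = mat_endo N (1\<^sub>m (Suc N))"
proof -
  have "rho N g * 1\<^sub>m (Suc N) * rho N g' = rho N (g ** g')"
    unfolding rho_mult by (simp add: right_mult_one_mat[of _ "Suc N" "Suc N"])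
  then show ?thesis by (simp add: conj_act_mat_endo assms rho_one)
qed

definition det_fun :: "nat \<Rightarrow> ('k::field symalg \<Rightarrow> 'k symalg) \<Rightarrow> 'k" where
  "det_fun N T = Determinant.det (endo_mat N T)"

lemma polyfun_le_det_fun: "polyfun_le endo_scale (endo N) (Suc N) (det_fun N)"
proof -
  let ?U = "{0..<Suc N}"
  have lin: "linear_map_on endo_scale (*) (endo N) (\<lambda>T. endo_mat N T $$ (i, j))" if "i < Suc N" "j < Suc N" for i j
    using that by (simp add: linear_map_on_def endo_mat_def lookup_add endo_scale_def sym_scale_def lookup_scale)
  have "polyfun_le endo_scale (endo N) (0 + card ?U) (\<lambda>T. signof \<pi> * (\<Prod>i\<in>?U. endo_mat N T $$ (i, \<pi> i)))"
    if "\<pi> permutes ?U" for \<pi>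
    using permutes_in_image[OF that]
    by (intro polyfun_le.mult polyfun_le.const polyfun_le_prod polyfun_le.linear lin) auto
  then have "polyfun_le endo_scale (endo N) (Suc N)
      (\<lambda>T. \<Sum>\<pi> | \<pi> permutes ?U. signof \<pi> * (\<Prod>i\<in>?U. endo_mat N T $$ (i, \<pi> i)))"
    by (intro polyfun_le_sum) (auto simp: finite_permutations)
  also have "(\<lambda>T. \<Sum>\<pi> | \<pi> permutes ?U. signof \<pi> * (\<Prod>i\<in>?U. endo_mat N T $$ (i, \<pi> i))) = det_fun N"
    by (simp add: fun_eq_iff det_fun_def det_def'[OF endo_mat_carrier])
  finally show ?thesis .
qed

lemma det_fun_conj_act:
  assumes "T \<in> endo N" "g ** g' = id2"
  shows "det_fun N (conj_act N g g' T) = det_fun N T"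
proof -
  note [simp] = mult_carrier_mat[of _ "Suc N" "Suc N" _ "Suc N"]
  have "Determinant.det (rho N g) * Determinant.det (rho N g') = Determinant.det (rho N (g ** g'))"
    unfolding rho_mult by (simp add: Determinant.det_mult[of _ "Suc N"])
  also have "\<dots> = 1" by (simp add: assms rho_one)
  finally have "Determinant.det (rho N g) * Determinant.det (rho N g') = 1" .
  then show ?thesis
    using assms
    by (simp add: det_fun_def endo_mat_conj_act Determinant.det_mult[of _ "Suc N"] mult.commute mult.left_commute)
qed

lemma det_fun_mat_endo: "A \<in> sqmats N \<Longrightarrow> det_fun N (mat_endo N A) = Determinant.det A"
  by (simp add: det_fun_def endo_mat_mat_endo)

lemma det_fun_0: "det_fun N 0 = 0"
  unfolding mat_endo_zero[of N, symmetric] by (subst det_fun_mat_endo) simp_all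

theorem proposition3p6:
  fixes p n :: nat and G :: "('k::alg_closed_field ^ 2 ^ 2) set"
  assumes "CHAR('k) = p" and "p > 0"
    and "subgroup G GL2" and "closed_in_GL2 G"
    and "\<exists>H. subgroup H GL2 \<and> H \<subseteq> G \<and> infinite H \<and> (\<forall>h\<in>H. unipotent h)"
  shows "delta (GL2\<lparr>carrier := G\<rparr>)
           (hom_module (GL2\<lparr>carrier := G\<rparr>) (sym_power (p ^ n - 1))) \<ge> p ^ n"
proof -
  define N where "N = p ^ n - 1"
  define \<Gamma> where "\<Gamma> = (GL2\<lparr>carrier := G\<rparr> :: ('k ^ 2 ^ 2) monoid)"
  define M where "M = hom_module \<Gamma> (sym_power N)"
  let ?I = "id2 :: 'k ^ 2 ^ 2"
  have char: "prime CHAR('k)" using assms(1,2) prime_CHAR_semidom by blast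
  have N: "Suc N = CHAR('k) ^ n" using assms(1,2) by (simp add: N_def)
  have M [simp]: "rep_space M = endo N" "rep_scale M = endo_scale"
    "\<And>g. rep_act M g = conj_act N g (inv\<^bsub>\<Gamma>\<^esub> g)"
    by (simp_all add: M_def rep_space_hom_module rep_scale_hom_module rep_act_hom_module)

  obtain H where H: "subgroup H GL2" "H \<subseteq> G" "infinite H" "\<And>h. h \<in> H \<Longrightarrow> unipotent h"
    using assms(5) by blast
  obtain h h' where h: "h ** h' = ?I" "h' ** h = ?I" and infH: "infinite {t. h ** upper t ** h' \<in> H}"
    using unipotent_subgroup_conj_upper[OF H(1,3,4)] by blast
  have inf: "infinite (UNIV :: 'k set)" using infH finite_subset[OF subset_UNIV] by blast
  have "infinite {t. h ** upper t ** h' \<in> G}"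
    using infH H(2) finite_subset[of "{t. h ** upper t ** h' \<in> H}" "{t. h ** upper t ** h' \<in> G}"]
    by blast
  then have uG: "h ** upper t ** h' \<in> G" for t by (rule closed_in_GL2_line[OF assms(4) h])

  interpret \<Gamma>: group \<Gamma>
    unfolding \<Gamma>_def using subgroup.subgroup_is_group[OF assms(3) group_GL2] .
  have carr: "carrier \<Gamma> = G" and mult: "\<And>a b. a \<otimes>\<^bsub>\<Gamma>\<^esub> b = a ** b" and one: "\<one>\<^bsub>\<Gamma>\<^esub> = ?I"
    by (simp_all add: \<Gamma>_def GL2_def)
  have invG: "inv\<^bsub>\<Gamma>\<^esub> g \<in> G" "inv\<^bsub>\<Gamma>\<^esub> (inv\<^bsub>\<Gamma>\<^esub> g) = g" "inv\<^bsub>\<Gamma>\<^esub> g ** g = ?I" "g ** inv\<^bsub>\<Gamma>\<^esub> g = ?I"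
    if "g \<in> G" for g
    using \<Gamma>.inv_closed[of g] \<Gamma>.inv_inv[of g] \<Gamma>.l_inv[of g] \<Gamma>.r_inv[of g] that
    by (simp_all add: carr mult one)
  have inv_u: "inv\<^bsub>\<Gamma>\<^esub> (h ** upper t ** h') = h ** upper (- t) ** h'" for t
  proof -
    have "h ** upper (- t) ** h' ** (h ** upper t ** h') = h ** (upper (- t) ** ((h' ** h) ** upper t)) ** h'"
      by (simp only: matrix_mul_assoc)
    also have "\<dots> = ?I" by (simp add: h upper_add upper_zero)
    finally show ?thesis using \<Gamma>.inv_equality[of _ "h ** upper t ** h'"] uG by (simp add: carr mult one)
  qed

  have inv_f: "f (conj_act N g (inv\<^bsub>\<Gamma>\<^esub> g) T) = f T" if "f \<in> invariants \<Gamma> M" "g \<in> G" "T \<in> endo N" for f g T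
    using that invG[of g] by (auto simp: invariants_def fun_action_def carr)
  \<comment> \<open>Composing an invariant of \<open>G\<close> with conjugation by \<open>h\<close>
    gives a function invariant under all \<open>upper t\<close>; the matrix \<open>h\<close> itself
    may lie outside \<open>G\<close>.\<close>
  have transported: "f (conj_act N h h' (conj_act N (upper t) (upper (- t)) T)) = f (conj_act N h h' T)"
    if f: "f \<in> invariants \<Gamma> M" and T: "T \<in> endo N" for f t T
  proof -
    have "h ** upper t = h ** upper t ** h' ** h" "upper (- t) ** h' = h' ** (h ** upper (- t) ** h')"
      by (simp_all add: matrix_mul_assoc[symmetric] h, simp add: matrix_mul_assoc h)
    then have "conj_act N h h' (conj_act N (upper t) (upper (- t)) T)
        = conj_act N (h ** upper t ** h') (inv\<^bsub>\<Gamma>\<^esub> (h ** upper t ** h')) (conj_act N h h' T)"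
      using T by (simp add: conj_act_conj_act conj_act_endo inv_u)
    then show ?thesis using inv_f[OF f uG] T by (simp add: conj_act_endo)
  qed
  have poly_h: "polyfun_le endo_scale (endo N) d (\<lambda>T. f (conj_act N h h' T))"
    if "polyfun_le endo_scale (endo N) d f" for d f
    using that by (rule polyfun_le_comp) (simp_all add: conj_act_endo conj_act_linear)

  have det_inv: "det_fun N \<in> plus_part (invariants_le \<Gamma> M (Suc N))"
    using invG polyfun_le_det_fun
    by (auto simp: plus_part_def invariants_le_def invariants_def polyfuns_def fun_action_def carr
        det_fun_conj_act det_fun_0 intro: exI[of _ "Suc N"])

  \<comment> \<open>Some degree works, so the \<open>LEAST\<close> in \<open>delta\<close> is
    attained and \<open>LeastI\<close> can be applied at the end.\<close>
  have "delta_set \<Gamma> M (invariants_le \<Gamma> M (Suc N))"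
    unfolding delta_set_def
  proof (intro conjI ballI)
    show "invariants_le \<Gamma> M (Suc N) \<subseteq> invariants \<Gamma> M" by (auto simp: invariants_le_def)
    fix w assume w: "w \<in> fixed_points \<Gamma> M - nullcone \<Gamma> M"
    then have wW: "w \<in> endo N" and wfix: "\<And>g. g \<in> G \<Longrightarrow> conj_act N g (inv\<^bsub>\<Gamma>\<^esub> g) w = w"
      by (auto simp: fixed_points_def carr)
    obtain f where f: "f \<in> invariants \<Gamma> M" "f 0 = 0" "f w \<noteq> 0"
      using w wW by (auto simp: nullcone_def plus_part_def)
    obtain d where d: "polyfun_le endo_scale (endo N) d f"
      using f(1) by (auto simp: invariants_def polyfuns_def)
    \<comment> \<open>Moving \<open>w\<close> back by \<open>h\<close> gives a point fixed by every
      \<open>upper t\<close>, so its matrix commutes with every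
      \<open>rho N (upper t)\<close>.\<close>
    define v where "v = conj_act N h' h w"
    have v: "v \<in> endo N" using wW by (simp add: v_def conj_act_endo)
    have vw: "conj_act N h h' v = w"
    proof -
      have "endo_mat N (conj_act N ?I ?I w) = endo_mat N w"
        using wW by (simp add: endo_mat_conj_act rho_one left_mult_one_mat[of _ "Suc N" "Suc N"]
            right_mult_one_mat[of _ "Suc N" "Suc N"])
      then have "conj_act N ?I ?I w = w" using wW by (intro endo_eqI[of _ N]) (auto simp: conj_act_endo)
      then show ?thesis using wW by (simp add: v_def conj_act_conj_act h)
    qed
    have comm: "rho N (upper t) * endo_mat N v = endo_mat N v * rho N (upper t)" for t
    proof -
      note [simp] = mult_carrier_mat[of _ "Suc N" "Suc N" _ "Suc N"]
      have "upper t ** h' = h' ** (h ** upper t ** h')" "h ** upper (- t) = h ** upper (- t) ** h' ** h"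
        by (simp_all add: matrix_mul_assoc[symmetric] h, simp add: matrix_mul_assoc h)
      then have "conj_act N (upper t) (upper (- t)) v
          = conj_act N h' h (conj_act N (h ** upper t ** h') (inv\<^bsub>\<Gamma>\<^esub> (h ** upper t ** h')) w)"
        using wW by (simp add: v_def conj_act_conj_act conj_act_endo inv_u)
      also have "\<dots> = v" using wfix[OF uG] by (simp add: v_def)
      finally have "rho N (upper t) * endo_mat N v * rho N (upper (- t)) = endo_mat N v"
        using endo_mat_conj_act[OF v, of "upper t" "upper (- t)"] by simp
      then have "endo_mat N v * rho N (upper t) = rho N (upper t) * endo_mat N v * rho N (upper (- t)) * rho N (upper t)"
        by simp
      also have "\<dots> = rho N (upper t) * endo_mat N v * (rho N (upper (- t)) * rho N (upper t))"
        by (simp add: assoc_mult_mat[of _ "Suc N" "Suc N" _ "Suc N" _ "Suc N"])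
      also have "\<dots> = rho N (upper t) * endo_mat N v"
        by (simp add: upper_add upper_zero rho_one right_mult_one_mat[of _ "Suc N" "Suc N"] flip: rho_mult)
      finally show ?thesis by simp
    qed
    let ?c = "endo_mat N v $$ (N, N)"
    have "f w = f (conj_act N h h' (mat_endo N (endo_mat N v)))" using v vw by (simp add: mat_endo_endo_mat)
    also have "\<dots> = f (conj_act N h h' (mat_endo N (?c \<cdot>\<^sub>m 1\<^sub>m (Suc N))))"
      using upper_invariant_eq_scalar[OF inf char N poly_h[OF d] transported[OF f(1)] endo_mat_carrier comm] .
    \<comment> \<open>A zero scalar would give \<open>f w = f 0 = 0\<close>.\<close>
    finally have "?c \<noteq> 0" using f(2,3) by (auto simp: mat_endo_zero conj_act_0)
    moreover have "Determinant.det (endo_mat N v) = ?c ^ Suc N"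
    proof -
      have "upper_triangular (endo_mat N v)"
        using upper_commutant(1)[OF inf char N endo_mat_carrier comm] by (auto simp: upper_triangular_def endo_mat_def less_Suc_eq_le)
      then have "Determinant.det (endo_mat N v) = prod_list (diag_mat (endo_mat N v))"
        by (rule det_upper_triangular) (rule endo_mat_carrier)
      also have "\<dots> = (\<Prod>i = 0..<Suc N. endo_mat N v $$ (i, i))"
        by (simp add: prod_list_diag_prod endo_mat_def)
      also have "\<dots> = (\<Prod>i = 0..<Suc N. ?c)"
        by (intro prod.cong refl upper_commutant(2)[OF inf char N endo_mat_carrier comm]) auto
      finally show ?thesis by simp
    qed
    moreover have "Determinant.det (endo_mat N v) = det_fun N w"
      using det_fun_conj_act[OF wW h(2)] by (simp add: v_def det_fun_def)
    ultimately show "\<exists>f\<in>plus_part (invariants_le \<Gamma> M (Suc N)). f w \<noteq> 0"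
      using det_inv by (intro bexI[of _ "det_fun N"]) auto
  qed
  moreover have "Suc N \<le> d" if D: "delta_set \<Gamma> M (invariants_le \<Gamma> M d)" for d
  proof (rule ccontr)
    assume "\<not> Suc N \<le> d"
    then have dN: "d \<le> N" by simp
    let ?e = "mat_endo N (1\<^sub>m (Suc N)) :: 'k symalg \<Rightarrow> 'k symalg"
    have "?e \<in> fixed_points \<Gamma> M"
      using invG by (auto simp: fixed_points_def mat_endo_endo carr conj_act_mat_endo_one)
    moreover have "?e \<notin> nullcone \<Gamma> M"
    proof
      assume "?e \<in> nullcone \<Gamma> M"
      moreover have "det_fun N \<in> plus_part (invariants \<Gamma> M)"
        using det_inv by (auto simp: plus_part_def invariants_le_def)
      ultimately have "det_fun N ?e = 0" by (auto simp: nullcone_def)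
      then show False by (simp add: det_fun_mat_endo)
    qed
    ultimately obtain f where f: "f \<in> plus_part (invariants_le \<Gamma> M d)" "f ?e \<noteq> 0"
      using D by (auto simp: delta_set_def)
    then have f0: "f 0 = 0" and fi: "f \<in> invariants \<Gamma> M" and fd: "polyfun_le endo_scale (endo N) d f"
      by (auto simp: plus_part_def invariants_le_def)
    have "f (conj_act N h h' ?e) = f (conj_act N h h' 0)"
    proof (cases "n = 0")
      case True
      then have "N = 0" using N by simp
      have "upoly_fun (d * 1) (\<lambda>t. f (conj_act N h h' (mat_endo N (t \<cdot>\<^sub>m 1\<^sub>m (Suc N)))))"
      proof (rule upoly_fun_mat_endo[OF poly_h[OF fd]])
        show "upoly_fun 1 (\<lambda>t. (t \<cdot>\<^sub>m 1\<^sub>m (Suc N)) $$ (i, j))" if "i \<le> N" "j \<le> N" for i j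
          using that by (simp add: upoly_fun_const upoly_fun_id)
      qed simp
      then obtain P where P: "degree P \<le> 0" "\<And>t. f (conj_act N h h' (mat_endo N (t \<cdot>\<^sub>m 1\<^sub>m (Suc N)))) = poly P t"
        using dN \<open>N = 0\<close> by (auto simp: upoly_fun_def)
      then obtain a where "P = [:a:]" by (metis degree_eq_zeroE le_zero_eq)
      moreover have "1 \<cdot>\<^sub>m 1\<^sub>m (Suc N) = (1\<^sub>m (Suc N) :: 'k mat)" by (rule eq_matI) auto
      ultimately show ?thesis using P(2)[of 1] P(2)[of 0] by (simp add: mat_endo_zero)
    next
      case False
      then have "n > 0" by simp
      then show ?thesis
        using upper_invariant_at_one[OF char _ N inf poly_h[OF fd] dN transported[OF fi]] by blast
    qed
    then show False using f(2) f0 h by (simp add: conj_act_mat_endo_one conj_act_0)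
  qed
  ultimately have "Suc N \<le> delta \<Gamma> M"
    unfolding delta_def by (metis (mono_tags, lifting) LeastI)
  then show ?thesis using N assms(1) by (simp add: \<Gamma>_def M_def N_def)
qed

end
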